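(* Let $T>0$. Let $\{A_{t,x}\}_{(t,x)\in[0,T]\times\mathbb{R}^n}$ be a family of maximal monotone operators $A_{t,x}:\mathbb{R}^n\rightrightarrows\mathbb{R}^n$ such that: (1.1) there are constants $L_1\ge 0$ and $0\le L_2<1$ with $\mathrm{dis}(A_{t,x},A_{s,y})\le L_1|t-s|+L_2\|x-y\|$ for all $t,s\in[0,T]$ and $x,y\in\mathbb{R}^n$; (1.2) there is $c_A>0$ with $\|A^0_{t,x}(y)\|\le c_A(1+\|x\|+\|y\|)$ for all $t\in[0,T]$, $x\in\mathbb{R}^n$ and $y\in\mathrm{dom}(A_{t,x})$. Let $f:[0,T]\times\mathbb{R}^n\to\mathbb{R}^n$ be continuous and suppose there is $c_f>0$ with $\|f(t,x)\|\le c_f(1+\|x\|)$ for all $t\in[0,T]$, $x\in\mathbb{R}^n$. Then for every $t_0\in[0,T]$ and every $x_0\in\mathrm{dom}(A_{t_0,x_0})$, the problem $$\dot x(t)\in f(t,x(t))-A_{t,x(t)}(x(t))\ \text{ for a.e. } t\in[t_0,T],\qquad x(t_0)=x_0,$$ has a solution $x(\cdot)$. In addition, $$\|\dot x(t)\|\le m(x_0)\quad\text{for a.e. } t\in[t_0,t_0+1]\cap[t_0,T],$$ where, for a fixed $\delta>0$ chosen so that $(1+\delta)L_2<1$, $$m(x_0):=\Big(2\|x_0\|+\frac{2c_1}{1-(1+\delta)L_2}\Big)\exp\Big(\frac{6c_1}{1-(1+\delta)L_2}\Big)>0,\qquad c_1:=c_f+\frac{1+(4\delta+1)c_A}{4\delta}+(1+\delta)L_1,$$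 depends only on $x_0,L_1,L_2,c_A,c_f$ and is continuous with respect to $x_0$. Therefore $$\|x(t)\|\le\|x_0\|+m(x_0)\quad\text{for all } t\in[t_0,t_0+1]\cap[t_0,T].$$
   Context: For a set-valued operator $F:\mathbb{R}^n\rightrightarrows\mathbb{R}^n$, $\mathrm{dom}(F)=\{z: F(z)\neq\emptyset\}$. For a maximal monotone $F$ and $z\in\mathrm{dom}(F)$, $F^0(z)$ denotes the element of minimal norm of the closed convex set $F(z)$. The (Vladimirov) pseudo-distance between two maximal monotone operators $F_1,F_2$ is $$\mathrm{dis}(F_1,F_2):=\sup\Big\{\frac{\langle\eta_1-\eta_2,z_2-z_1\rangle}{1+\|\eta_1\|+\|\eta_2\|}:\ z_i\in\mathrm{dom}(F_i),\ \eta_i\in F_i(z_i),\ i=1,2\Big\}.$$ A solution is an absolutely continuous function $x:[t_0,T]\to\mathbb{R}^n$ with $x(t_0)=x_0$ satisfying the inclusion for almost every $t$. *)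

theory Defs
  imports "HOL-Analysis.Analysis"
begin

type_synonym 'n operator = "real ^ 'n \<Rightarrow> (real ^ 'n) set"

definition op_dom :: "('n::finite) operator \<Rightarrow> (real ^ 'n) set" where
  "op_dom F = {z. F z \<noteq> {}}"

definition monotone_op :: "('n::finite) operator \<Rightarrow> bool" where
  "monotone_op F \<longleftrightarrow>
     (\<forall>z w. \<forall>\<eta>\<in>F z. \<forall>\<zeta>\<in>F w. (\<eta> - \<zeta>) \<bullet> (z - w) \<ge> 0)"

definition maximal_monotone_op :: "('n::finite) operator \<Rightarrow> bool" where
  "maximal_monotone_op F \<longleftrightarrow>
     monotone_op F \<and> (\<forall>G. monotone_op G \<and> (\<forall>z. F z \<subseteq> G z) \<longrightarrow> G = F)"

text \<open>The minimal section \<open>F\<^sup>0(z)\<close>. For maximal monotone \<open>F\<close> and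
  \<open>z \<in> op_dom F\<close> the set \<open>F z\<close> is nonempty, closed and convex, so the description is proper;
  otherwise the value carries no meaning.\<close>

definition min_section :: "('n::finite) operator \<Rightarrow> real ^ 'n \<Rightarrow> real ^ 'n" where
  "min_section F z = (THE \<eta>. \<eta> \<in> F z \<and> (\<forall>\<zeta>\<in>F z. norm \<eta> \<le> norm \<zeta>))"

text \<open>The supremum may be \<open>+\<infinity>\<close>, hence it is taken in \<^typ>\<open>ereal\<close>.\<close>

definition vladimirov_dis :: "('n::finite) operator \<Rightarrow> 'n operator \<Rightarrow> ereal" where
  "vladimirov_dis F\<^sub>1 F\<^sub>2 =
     Sup {ereal (((\<eta>\<^sub>1 - \<eta>\<^sub>2) \<bullet> (z\<^sub>2 - z\<^sub>1)) / (1 + norm \<eta>\<^sub>1 + norm \<eta>\<^sub>2)) | z\<^sub>1 z\<^sub>2 \<eta>\<^sub>1 \<eta>\<^sub>2.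
            z\<^sub>1 \<in> op_dom F\<^sub>1 \<and> z\<^sub>2 \<in> op_dom F\<^sub>2 \<and> \<eta>\<^sub>1 \<in> F\<^sub>1 z\<^sub>1 \<and> \<eta>\<^sub>2 \<in> F\<^sub>2 z\<^sub>2}"

definition absolutely_continuous_on_interval ::
    "real \<Rightarrow> real \<Rightarrow> (real \<Rightarrow> 'b::real_normed_vector) \<Rightarrow> bool" where
  "absolutely_continuous_on_interval a b x \<longleftrightarrow>
     (\<forall>\<epsilon>>0. \<exists>\<rho>>0. \<forall>(N::nat) u v.
        (\<forall>i<N. a \<le> u i \<and> u i \<le> v i \<and> v i \<le> b) \<longrightarrow>
        disjoint_family_on (\<lambda>i. {u i<..<v i}) {..<N} \<longrightarrow>
        (\<Sum>i<N. v i - u i) < \<rho> \<longrightarrow>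
        (\<Sum>i<N. norm (x (v i) - x (u i))) < \<epsilon>)"

text \<open>Trajectories are total functions of which only the restriction to \<open>{t0..T}\<close> matters;
  derivatives are therefore taken within \<open>{t0..T}\<close>.\<close>

definition is_solution ::
    "(real \<Rightarrow> real ^ 'n \<Rightarrow> ('n::finite) operator) \<Rightarrow> (real \<Rightarrow> real ^ 'n \<Rightarrow> real ^ 'n) \<Rightarrow>
     real \<Rightarrow> real \<Rightarrow> real ^ 'n \<Rightarrow> (real \<Rightarrow> real ^ 'n) \<Rightarrow> bool" where
  "is_solution A f t0 T x0 x \<longleftrightarrow>
     absolutely_continuous_on_interval t0 T x \<and>
     x t0 = x0 \<and>
     (AE t in lebesgue_on {t0..T}.
        x differentiable (at t within {t0..T}) \<and>
        vector_derivative x (at t within {t0..T}) \<in> {f t (x t) - \<eta> | \<eta>. \<eta> \<in> A t (x t) (x t)})"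

definition c1_const :: "real \<Rightarrow> real \<Rightarrow> real \<Rightarrow> real \<Rightarrow> real" where
  "c1_const \<delta> L\<^sub>1 c\<^sub>A c\<^sub>f = c\<^sub>f + (1 + (4 * \<delta> + 1) * c\<^sub>A) / (4 * \<delta>) + (1 + \<delta>) * L\<^sub>1"

definition m_bound ::
    "real \<Rightarrow> real \<Rightarrow> real \<Rightarrow> real \<Rightarrow> real \<Rightarrow> real ^ ('n::finite) \<Rightarrow> real" where
  "m_bound \<delta> L\<^sub>1 L\<^sub>2 c\<^sub>A c\<^sub>f x0 =
     (2 * norm x0 + 2 * c1_const \<delta> L\<^sub>1 c\<^sub>A c\<^sub>f / (1 - (1 + \<delta>) * L\<^sub>2)) *
     exp (6 * c1_const \<delta> L\<^sub>1 c\<^sub>A c\<^sub>f / (1 - (1 + \<delta>) * L\<^sub>2))"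

end

theory Submission
  imports Defs "HOL-Complex_Analysis.Great_Picard"
begin

text \<open>
  The state is frozen at the previous node of an implicit Euler scheme: \<open>X (i + 1)\<close> is the resolvent of
  the operator \<open>A t\<^sub>i\<^sub>+\<^sub>1 (X i)\<close> at \<open>X i + h f(t\<^sub>i, X i)\<close>. Testing the pseudo-distance of two consecutive
  operators on the new velocity and on the minimal section at \<open>X i\<close> bounds the discrete speed by
  \<open>v\<^sub>i\<^sub>+\<^sub>1 \<le> (1 + \<delta>) L\<^sub>2 v\<^sub>i + c\<^sub>1 (1 + \<parallel>X i\<parallel> + \<parallel>X (i - 1)\<parallel>)\<close>, and since \<open>(1 + \<delta>) L\<^sub>2 < 1\<close> a discrete
  Gronwall argument with \<open>C = c\<^sub>1 / (1 - (1 + \<delta>) L\<^sub>2)\<close> gives speeds at most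
  \<open>C (1 + 2 \<parallel>x0\<parallel>) exp (2 C (t - t0))\<close>, uniformly in \<open>h\<close> and up to \<open>T\<close>. The interpolants therefore have a Lipschitz
  uniform limit, and maximality turns the averaged monotonicity inequalities into the inclusion at
  every point of differentiability.
\<close>

section \<open>Almost everywhere differentiability of Lipschitz curves\<close>

text \<open>Freezing the state makes every step a resolvent of one maximal monotone operator, so no
  equation in the state has to be solved. The price is that consecutive steps use different
  operators, between which monotonicity fails by a defect containing \<open>L\<^sub>2\<close> times
  the last increment. The denominator in the pseudo-distance makes the resulting inequality
  quadratic in the new speed; linearising its square root by a weighted arithmetic-geometric mean is
  the origin of \<delta>, with \<open>1 + \<delta>\<close> in front of \<open>L\<^sub>2\<close> and
  \<open>1 / (4 * \<delta>)\<close> in \<open>c1_const\<close>. The minimal section is the right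
  test element because its growth is linear in the state. With the previous velocity in its place,
  the old speed would enter with a coefficient of at least 1 whatever \<open>h\<close> is, and the
  recursion would not close. Since no derivative is constructed as a weak limit, the limit curve has
  to get its derivative from being Lipschitz.\<close>

lemma Vitali_intervals:
  fixes E U :: "real set" and Q :: "real \<Rightarrow> real \<Rightarrow> bool"
  assumes "open U" "E \<subseteq> U"
    and Q: "\<And>x d. x \<in> E \<Longrightarrow> d > 0 \<Longrightarrow> \<exists>u v. u < v \<and> v - u < d \<and> u \<le> x \<and> x \<le> v \<and> Q u v"
  obtains C where "countable C" "\<And>c. c \<in> C \<Longrightarrow> fst c < snd c \<and> {fst c..snd c} \<subseteq> U \<and> Q (fst c) (snd c)"
    "disjoint_family_on (\<lambda>c. {fst c<..<snd c}) C"
    "negligible (E - (\<Union>c\<in>C. {fst c<..<snd c}))"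
proof -
  define K where "K = {c. fst c < snd c \<and> {fst c..snd c} \<subseteq> U \<and> Q (fst c) (snd c)}"
  define m where "m = (\<lambda>c::real\<times>real. (fst c + snd c) / 2)"
  define r where "r = (\<lambda>c::real\<times>real. (snd c - fst c) / 2)"
  have cb: "cball (m c) (r c) = {fst c..snd c}" and bl: "ball (m c) (r c) = {fst c<..<snd c}" for c
    unfolding m_def r_def cball_eq_atLeastAtMost ball_eq_greaterThanLessThan
    by (simp_all add: field_simps)
  \<comment> \<open>A covering interval need only contain \<open>x\<close>, possibly as an end
    point, so one-sided slopes qualify; the covering theorem for balls does not ask for
    \<open>x\<close> at the centre.\<close>
  have cov: "\<exists>c. c \<in> K \<and> x \<in> cball (m c) (r c) \<and> r c < d" if x: "x \<in> E" "d > 0" for x d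
  proof -
    obtain e where e: "e > 0" "ball x e \<subseteq> U"
      using assms x by (meson openE subsetD)
    obtain u v where uv: "u < v" "v - u < min d e" "u \<le> x" "x \<le> v" "Q u v"
      using Q[of x "min d e"] x e by auto
    have "{u..v} \<subseteq> ball x e"
      using uv by (auto simp: dist_real_def)
    with uv e have "(u, v) \<in> K"
      by (auto simp: K_def)
    moreover have "x \<in> cball (m (u, v)) (r (u, v))"
      unfolding cb using uv by auto
    moreover have "r (u, v) < d"
      using uv by (auto simp: r_def)
    ultimately show ?thesis by blast
  qed
  have pos: "0 < r c" if "c \<in> K" for c
    using that by (auto simp: K_def r_def)
  obtain C where C: "countable C" "C \<subseteq> K"
     "pairwise (\<lambda>i j. disjnt (cball (m i) (r i)) (cball (m j) (r j))) C"
     "negligible (E - (\<Union>i \<in> C. cball (m i) (r i)))"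
    using Vitali_covering_theorem_cballs[of K r E m, OF pos cov] by blast
  have "negligible ((\<Union>c\<in>C. {fst c, snd c}))"
    using C(1) by (intro negligible_countable_Union) auto
  then have "negligible ((E - (\<Union>i \<in> C. cball (m i) (r i))) \<union> (\<Union>c\<in>C. {fst c, snd c}))"
    using C(4) by (simp add: negligible_Un)
  then have neg: "negligible (E - (\<Union>c\<in>C. {fst c<..<snd c}))"
    unfolding cb by (rule negligible_subset) force
  have "disjoint_family_on (\<lambda>c. {fst c<..<snd c}) C"
    unfolding disjoint_family_on_def
  proof (intro ballI impI)
    fix a b assume "a \<in> C" "b \<in> C" "a \<noteq> b"
    then have "{fst a..snd a} \<inter> {fst b..snd b} = {}"
      using C(3) unfolding cb pairwise_def disjnt_def by blast
    then show "{fst a<..<snd a} \<inter> {fst b<..<snd b} = {}"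
      by (auto simp: disjoint_iff)
  qed
  with C neg show thesis
    by (intro that[of C]) (auto simp: K_def)
qed

lemma emeasure_interval_measure_Ioo:
  assumes "u \<le> v" "mono F" "continuous_on UNIV F"
  shows "emeasure (interval_measure F) {u<..<v} = ennreal (F v - F u)"
proof -
  have m: "\<And>x y. x \<le> y \<Longrightarrow> F x \<le> F y" using assms(2) by (simp add: monoD)
  have rc: "\<And>a. continuous (at_right a) F"
    using assms(3) by (auto intro: continuous_within_subset simp: continuous_on_eq_continuous_within)
  have pt: "emeasure (interval_measure F) {v} = 0"
    using emeasure_interval_measure_Icc[OF order_refl m assms(3), of v] by simp
  show ?thesis
  proof (cases "u = v")
    case False
    have "emeasure (interval_measure F) ({u<..<v} \<union> {v}) =
        emeasure (interval_measure F) {u<..<v} + emeasure (interval_measure F) {v}"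
      by (intro plus_emeasure[symmetric]) auto
    moreover have "{u<..<v} \<union> {v} = {u<..v}" using False assms(1) by auto
    ultimately show ?thesis
      using emeasure_interval_measure_Ioc[OF assms(1) m rc] pt by simp
  qed simp
qed

lemma emeasure_UN_le:
  assumes "countable C" "disjoint_family_on X C" "sets M = sets N"
    and "\<And>c. c \<in> C \<Longrightarrow> X c \<in> sets M"
    and "\<And>c. c \<in> C \<Longrightarrow> a * emeasure M (X c) \<le> b * emeasure N (X c)"
  shows "a * emeasure M (\<Union>c\<in>C. X c) \<le> b * emeasure N (\<Union>c\<in>C. X c)"
proof -
  have "a * emeasure M (\<Union>c\<in>C. X c) = (\<integral>\<^sup>+c. a * emeasure M (X c) \<partial>count_space C)"
    using assms by (subst emeasure_UN_countable) (auto simp: nn_integral_cmult)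
  also have "\<dots> \<le> (\<integral>\<^sup>+c. b * emeasure N (X c) \<partial>count_space C)"
    using assms by (intro nn_integral_mono) auto
  also have "\<dots> = b * emeasure N (\<Union>c\<in>C. X c)"
    using assms by (subst emeasure_UN_countable) (auto simp: nn_integral_cmult)
  finally show ?thesis .
qed

text \<open>Let \<open>s\<close> be the outer measure of \<open>E\<close>. A Vitali cover of \<open>E\<close> inside an open \<open>U\<close> by
  intervals of slope below \<open>p\<close> has union \<open>V\<close>, and a second cover inside \<open>V\<close> by intervals of slope
  above \<open>q\<close> has union \<open>W\<close>; measuring both with the Stieltjes measure of \<open>F\<close> gives
  \<open>q s \<le> q \<bar>W\<bar> \<le> \<mu> W \<le> \<mu> V \<le> p \<bar>U\<bar>\<close>, and \<open>\<bar>U\<bar>\<close> can be taken close to \<open>s\<close>.\<close>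

lemma negligible_slope_gap_bounded:
  fixes F :: "real \<Rightarrow> real"
  assumes F: "mono F" "continuous_on UNIV F" and pq: "0 < p" "p < q"
    and E: "E \<subseteq> {l<..<h}"
    and lo: "\<And>x d. x \<in> E \<Longrightarrow> d > 0 \<Longrightarrow> \<exists>u v. u < v \<and> v - u < d \<and> u \<le> x \<and> x \<le> v \<and> F v - F u < p * (v - u)"
    and hi: "\<And>x d. x \<in> E \<Longrightarrow> d > 0 \<Longrightarrow> \<exists>u v. u < v \<and> v - u < d \<and> u \<le> x \<and> x \<le> v \<and> F v - F u > q * (v - u)"
  shows "negligible E"
proof -
  \<comment> \<open>Nothing says that \<open>E\<close> is measurable, so its outer measure
    \<open>s\<close> is taken over open supersets of finite measure; boundedness of \<open>E\<close>
    provides one.\<close>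
  define \<O> where "\<O> = {U. open U \<and> E \<subseteq> U \<and> U \<in> lmeasurable}"
  define s where "s = (INF U\<in>\<O>. measure lebesgue U)"
  have I0: "{l<..<h} \<in> \<O>"
    using E by (auto simp: \<O>_def lmeasurable_interval)
  have bdd: "bdd_below (measure lebesgue ` \<O>)"
    by (auto intro!: bdd_belowI2[of _ 0])
  have s_le: "s \<le> measure lebesgue U" if "U \<in> \<O>" for U
    unfolding s_def using bdd that by (rule cINF_lower)
  have approx: "\<exists>U\<in>\<O>. measure lebesgue U < s + e" if "e > 0" for e
    using cINF_less_iff[of \<O> "measure lebesgue" "s + e"] bdd I0 that unfolding s_def by fastforce
  have "0 \<le> s"
    unfolding s_def using I0 by (intro cINF_greatest) auto
  have key: "q * s \<le> p * measure lebesgue U" if U: "U \<in> \<O>" for U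
  proof -
    have "open U" "E \<subseteq> U" "U \<in> lmeasurable" using U by (auto simp: \<O>_def)
    let ?\<mu> = "interval_measure F"
    obtain C where C: "countable C" "\<And>c. c \<in> C \<Longrightarrow> fst c < snd c \<and> {fst c..snd c} \<subseteq> U \<and>
        F (snd c) - F (fst c) < p * (snd c - fst c)"
      "disjoint_family_on (\<lambda>c. {fst c<..<snd c}) C" "negligible (E - (\<Union>c\<in>C. {fst c<..<snd c}))"
      by (rule Vitali_intervals[OF \<open>open U\<close> \<open>E \<subseteq> U\<close> lo]) auto
    define V where "V = (\<Union>c\<in>C. {fst c<..<snd c})"
    have "open V" by (auto simp: V_def)
    have hi': "\<exists>u v. u < v \<and> v - u < d \<and> u \<le> x \<and> x \<le> v \<and> F v - F u > q * (v - u)"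
      if "x \<in> E \<inter> V" "d > 0" for x d using hi that by blast
    obtain D where D: "countable D" "\<And>c. c \<in> D \<Longrightarrow> fst c < snd c \<and> {fst c..snd c} \<subseteq> V \<and>
        F (snd c) - F (fst c) > q * (snd c - fst c)"
      "disjoint_family_on (\<lambda>c. {fst c<..<snd c}) D" "negligible (E \<inter> V - (\<Union>c\<in>D. {fst c<..<snd c}))"
      by (rule Vitali_intervals[OF \<open>open V\<close> Int_lower2 hi']) auto
    define W where "W = (\<Union>c\<in>D. {fst c<..<snd c})"
    have "open W" by (auto simp: W_def)
    have "V \<subseteq> U" unfolding V_def using C(2) by force
    have "W \<subseteq> V" unfolding W_def using D(2) by force
    have "1 * emeasure ?\<mu> V \<le> ennreal p * emeasure lborel V"
      unfolding V_def
    proof (rule emeasure_UN_le[OF C(1,3)])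
      fix c assume c: "c \<in> C"
      have "1 * emeasure ?\<mu> {fst c<..<snd c} = ennreal (F (snd c) - F (fst c))"
        using C(2)[OF c] F by (simp add: emeasure_interval_measure_Ioo)
      also have "\<dots> \<le> ennreal (p * (snd c - fst c))"
        using C(2)[OF c] by (intro ennreal_leI) auto
      also have "\<dots> = ennreal p * emeasure lborel {fst c<..<snd c}"
        using C(2)[OF c] pq by (simp add: ennreal_mult)
      finally show "1 * emeasure ?\<mu> {fst c<..<snd c} \<le> ennreal p * emeasure lborel {fst c<..<snd c}" .
    qed auto
    moreover have "ennreal q * emeasure lborel W \<le> 1 * emeasure ?\<mu> W"
      unfolding W_def
    proof (rule emeasure_UN_le[OF D(1,3)])
      fix c assume c: "c \<in> D"
      have "ennreal q * emeasure lborel {fst c<..<snd c} = ennreal (q * (snd c - fst c))"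
        using D(2)[OF c] pq by (simp add: ennreal_mult)
      also have "\<dots> \<le> ennreal (F (snd c) - F (fst c))"
        using D(2)[OF c] by (intro ennreal_leI) auto
      also have "\<dots> = 1 * emeasure ?\<mu> {fst c<..<snd c}"
        using D(2)[OF c] F by (simp add: emeasure_interval_measure_Ioo)
      finally show "ennreal q * emeasure lborel {fst c<..<snd c} \<le> 1 * emeasure ?\<mu> {fst c<..<snd c}" .
    qed auto
    moreover have "emeasure ?\<mu> W \<le> emeasure ?\<mu> V"
      using \<open>W \<subseteq> V\<close> \<open>open V\<close> by (intro emeasure_mono) auto
    moreover have "emeasure lborel V \<le> emeasure lborel U"
      using \<open>V \<subseteq> U\<close> \<open>open U\<close> by (intro emeasure_mono) auto
    ultimately have "ennreal q * emeasure lborel W \<le> ennreal p * emeasure lborel U"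
      by (metis (no_types, lifting) mult_1 mult_left_mono order_trans zero_le)
    moreover have "W \<in> lmeasurable"
      using \<open>open W\<close> \<open>W \<subseteq> V\<close> \<open>V \<subseteq> U\<close> \<open>U \<in> lmeasurable\<close>
      by (intro fmeasurableI2[of U lebesgue W]) auto
    moreover have "emeasure lborel X = ennreal (measure lebesgue X)" if "X \<in> lmeasurable" "open X" for X :: "real set"
      using that emeasure_eq_measure2[of X lebesgue] by (simp add: emeasure_completion)
    ultimately have qW: "q * measure lebesgue W \<le> p * measure lebesgue U"
      using \<open>open U\<close> \<open>open W\<close> \<open>U \<in> lmeasurable\<close> pq by (simp add: ennreal_mult[symmetric])
    have neg: "negligible (E - W)"
      using negligible_Un[OF C(4) D(4)] unfolding V_def[symmetric] W_def[symmetric]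
      by (rule negligible_subset) blast
    \<comment> \<open>\<open>W\<close> misses a null part of \<open>E\<close>; an open set of
      measure below \<open>e\<close> around that part completes \<open>W\<close> to an admissible
      superset.\<close>
    have "s \<le> measure lebesgue W + e" if "e > 0" for e
    proof -
      obtain G where G: "open G" "E - W \<subseteq> G" "emeasure lebesgue (G - (E - W)) < ennreal e"
          "G - (E - W) \<in> lmeasurable"
        using sets_lebesgue_outer_open[of "E - W" e] negligible_imp_sets[OF neg] \<open>e > 0\<close> by metis
      have GEW: "G = (G - (E - W)) \<union> (E - W)" using G by blast
      have "measure lebesgue (G - (E - W)) < e"
        using G \<open>e > 0\<close> by (simp add: emeasure_eq_measure2 ennreal_less_iff)
      moreover have "measure lebesgue G \<le> measure lebesgue (G - (E - W)) + measure lebesgue (E - W)"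
        by (subst GEW, rule measure_Un_le) (use G negligible_imp_sets[OF neg] in auto)
      ultimately have mG: "measure lebesgue G < e"
        using negligible_imp_measure0[OF neg] by simp
      have "G \<in> lmeasurable"
        by (subst GEW) (use G negligible_imp_measurable[OF neg] in blast)
      have "W \<union> G \<in> \<O>"
        using G \<open>open W\<close> \<open>G \<in> lmeasurable\<close> \<open>W \<in> lmeasurable\<close> by (auto simp: \<O>_def)
      from s_le[OF this] have "s \<le> measure lebesgue (W \<union> G)" .
      also have "\<dots> \<le> measure lebesgue W + measure lebesgue G"
        using \<open>G \<in> lmeasurable\<close> \<open>W \<in> lmeasurable\<close> by (intro measure_Un_le) auto
      finally show ?thesis using mG by linarith
    qed
    then have "s \<le> measure lebesgue W"
      using field_le_epsilon by blast
    then have "q * s \<le> q * measure lebesgue W"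
      using pq by (intro mult_left_mono) auto
    with qW show ?thesis by linarith
  qed
  have "q * s \<le> p * s + e" if "e > 0" for e
  proof -
    obtain U where "U \<in> \<O>" "measure lebesgue U < s + e / p"
      using approx[of "e / p"] pq \<open>e > 0\<close> by auto
    then have "p * measure lebesgue U \<le> p * (s + e / p)"
      using pq by (intro mult_left_mono) auto
    then have "p * measure lebesgue U \<le> p * s + e"
      using pq by (simp add: distrib_left)
    then show ?thesis
      using key[OF \<open>U \<in> \<O>\<close>] by linarith
  qed
  then have "q * s \<le> p * s" using field_le_epsilon by blast
  with pq \<open>0 \<le> s\<close> have "s = 0"
    by (simp add: mult_le_cancel_right)
  show ?thesis
    unfolding negligible_outer_le
  proof (intro allI impI)
    fix e :: real assume "e > 0"
    then obtain U where "U \<in> \<O>" "measure lebesgue U < e"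
      using approx[of e] \<open>s = 0\<close> by auto
    then show "\<exists>T. E \<subseteq> T \<and> T \<in> lmeasurable \<and> measure lebesgue T \<le> e"
      by (intro exI[of _ U]) (auto simp: \<O>_def)
  qed
qed

lemma negligible_slope_gap:
  fixes F :: "real \<Rightarrow> real"
  assumes F: "mono F" "continuous_on UNIV F" and pq: "0 < p" "p < q"
    and lo: "\<And>x d. x \<in> E \<Longrightarrow> d > 0 \<Longrightarrow> \<exists>u v. u < v \<and> v - u < d \<and> u \<le> x \<and> x \<le> v \<and> F v - F u < p * (v - u)"
    and hi: "\<And>x d. x \<in> E \<Longrightarrow> d > 0 \<Longrightarrow> \<exists>u v. u < v \<and> v - u < d \<and> u \<le> x \<and> x \<le> v \<and> F v - F u > q * (v - u)"
  shows "negligible E"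
proof -
  have "negligible (E \<inter> {- real n<..<real n})" for n
    by (rule negligible_slope_gap_bounded[OF F pq Int_lower2]) (use lo in blast, use hi in blast)
  then have "negligible (\<Union>n. E \<inter> {- real n<..<real n})" by blast
  moreover have "E \<subseteq> (\<Union>n. E \<inter> {- real n<..<real n})"
  proof
    fix x assume "x \<in> E"
    moreover obtain n where "\<bar>x\<bar> < real n" using reals_Archimedean2 by blast
    ultimately have "x \<in> E \<inter> {- real n<..<real n}" by (auto simp: abs_less_iff)
    then show "x \<in> (\<Union>n. E \<inter> {- real n<..<real n})" by blast
  qed
  ultimately show ?thesis by (rule negligible_subset)
qed

text \<open>Where the difference quotient has no limit, two rationals separate its lower and upper
  limits, so the point lies in one of countably many null sets. The Lipschitz bound rules out an
  infinite limit; monotonicity makes \<open>l\<close> nonnegative and hence the rationals positive,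
  as the slope comparison requires.\<close>

lemma differentiable_ae_mono_Lipschitz:
  fixes F :: "real \<Rightarrow> real"
  assumes F: "mono F" and L: "K-lipschitz_on UNIV F"
  shows "negligible {x. \<not> F differentiable (at x)}"
proof -
  define lo where "lo = (\<lambda>p x. \<forall>d>0. \<exists>u v. u < v \<and> v - u < d \<and> u \<le> x \<and> x \<le> v \<and> F v - F u < p * (v - u))"
  define hi where "hi = (\<lambda>q x. \<forall>d>0. \<exists>u v. u < v \<and> v - u < d \<and> u \<le> x \<and> x \<le> v \<and> F v - F u > q * (v - u))"
  have cont: "continuous_on UNIV F" using L by (rule lipschitz_on_continuous_on)
  have "negligible {x. lo p x \<and> hi q x}" if "0 < p" "p < q" for p q
    by (rule negligible_slope_gap[OF F cont that]) (auto simp: lo_def hi_def)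
  then have "negligible (\<Union>(p, q)\<in>{(p, q). p \<in> \<rat> \<and> q \<in> \<rat> \<and> 0 < p \<and> p < q}. {x. lo p x \<and> hi q x})"
    by (intro negligible_countable_Union countable_image countable_subset[OF _ countable_SIGMA[OF countable_rat countable_rat]]) auto
  then show ?thesis
  proof (rule negligible_subset, intro subsetI)
    fix x assume "x \<in> {x. \<not> F differentiable (at x)}"
    then have nd: "\<not> F differentiable (at x)" by simp
    define Q where "Q = (\<lambda>y. (F y - F x) / (y - x))"
    have Q0: "0 \<le> Q y" for y
      unfolding Q_def using monoD[OF F, of x y] monoD[OF F, of y x]
      by (cases "x \<le> y") (auto simp: divide_nonneg_nonneg divide_nonpos_nonpos)
    have QK: "Q y \<le> K" for y
    proof -
      have "\<bar>F y - F x\<bar> \<le> K * \<bar>y - x\<bar>"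
        using lipschitz_onD[OF L, of y x] by (simp add: dist_real_def)
      then have "\<bar>Q y\<bar> \<le> K"
        using lipschitz_on_nonneg[OF L] unfolding Q_def abs_divide
        by (cases "y = x") (simp_all add: divide_le_eq)
      then show ?thesis by simp
    qed
    define l u where "l = Liminf (at x) (\<lambda>y. ereal (Q y))" and "u = Limsup (at x) (\<lambda>y. ereal (Q y))"
    have l0: "0 \<le> l"
      unfolding l_def using Q0 by (intro Liminf_bounded) (auto intro!: always_eventually)
    have uK: "u \<le> ereal K"
      unfolding u_def using QK by (intro Limsup_bounded) (auto intro!: always_eventually)
    have lu: "l \<le> u" unfolding l_def u_def by (intro Liminf_le_Limsup) auto
    have "l \<noteq> u"
    proof
      assume "l = u"
      with l0 uK obtain D where D: "l = ereal D" by (cases l) auto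
      have "((\<lambda>y. ereal (Q y)) \<longlongrightarrow> ereal D) (at x)"
        using \<open>l = u\<close> D by (intro Liminf_eq_Limsup) (auto simp: l_def u_def)
      then have "(Q \<longlongrightarrow> D) (at x)" by simp
      then have "(F has_field_derivative D) (at x)"
        by (simp add: has_field_derivative_iff Q_def)
      with nd show False
        using field_differentiable_def field_differentiable_imp_differentiable by blast
    qed
    with lu have "l < u" by simp
    then obtain p where p: "l < ereal (real_of_rat p)" "ereal (real_of_rat p) < u"
      using ereal_dense3 by blast
    then obtain q where q: "ereal (real_of_rat p) < ereal (real_of_rat q)" "ereal (real_of_rat q) < u"
      using ereal_dense3 by blast
    let ?p = "real_of_rat p" and ?q = "real_of_rat q"
    have lo_freq: "\<exists>\<^sub>F y in at x. Q y < ?p"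
    proof (rule ccontr)
      assume "\<not> ?thesis"
      then have "ereal ?p \<le> l"
        unfolding l_def not_frequently by (intro Liminf_bounded) (auto elim: eventually_mono)
      with p show False by simp
    qed
    have hi_freq: "\<exists>\<^sub>F y in at x. Q y > ?q"
    proof (rule ccontr)
      assume "\<not> ?thesis"
      then have "u \<le> ereal ?q"
        unfolding u_def not_frequently by (intro Limsup_bounded) (auto elim: eventually_mono)
      with q show False by simp
    qed
    have slope: "F (max x y) - F (min x y) = Q y * (max x y - min x y)" if "y \<noteq> x" for y
      using that by (auto simp: Q_def max_def min_def field_simps)
    have interval: "\<exists>u v. u < v \<and> v - u < d \<and> u \<le> x \<and> x \<le> v \<and> F v - F u = Q y * (v - u)"
      if "y \<noteq> x" "dist y x < d" for y d
      using that slope[OF that(1)]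
      by (intro exI[of _ "min x y"] exI[of _ "max x y"]) (auto simp: dist_real_def)
    have "lo ?p x"
      unfolding lo_def
    proof (intro allI impI)
      fix d :: real assume "d > 0"
      then obtain y where "y \<noteq> x" "dist y x < d" and y: "Q y < ?p"
        using lo_freq unfolding frequently_at by blast
      then obtain u v where "u < v \<and> v - u < d \<and> u \<le> x \<and> x \<le> v \<and> F v - F u = Q y * (v - u)"
        using interval by blast
      with y show "\<exists>u v. u < v \<and> v - u < d \<and> u \<le> x \<and> x \<le> v \<and> F v - F u < ?p * (v - u)"
        by (intro exI[of _ u] exI[of _ v]) auto
    qed
    moreover have "hi ?q x"
      unfolding hi_def
    proof (intro allI impI)
      fix d :: real assume "d > 0"
      then obtain y where "y \<noteq> x" "dist y x < d" and y: "Q y > ?q"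
        using hi_freq unfolding frequently_at by blast
      then obtain u v where "u < v \<and> v - u < d \<and> u \<le> x \<and> x \<le> v \<and> F v - F u = Q y * (v - u)"
        using interval by blast
      with y show "\<exists>u v. u < v \<and> v - u < d \<and> u \<le> x \<and> x \<le> v \<and> F v - F u > ?q * (v - u)"
        by (intro exI[of _ u] exI[of _ v]) auto
    qed
    moreover have "0 < ?p" using le_less_trans[OF l0 p(1)] by simp
    moreover have "?p < ?q" using q by simp
    ultimately show "x \<in> (\<Union>(p, q)\<in>{(p, q). p \<in> \<rat> \<and> q \<in> \<rat> \<and> 0 < p \<and> p < q}. {x. lo p x \<and> hi q x})"
      by (intro UN_I[of "(?p, ?q)"]) auto
  qed
qed

text \<open>Each component becomes monotone after adding \<open>K * t\<close>, which does not affect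
  differentiability. Clamping the argument to \<open>{a..b}\<close> first extends the curve to the
  whole line with the same constant.\<close>

lemma ae_differentiable_Lipschitz:
  fixes x :: "real \<Rightarrow> 'a::euclidean_space"
  assumes L: "K-lipschitz_on {a..b} x"
  shows "AE t in lebesgue_on {a..b}. x differentiable (at t within {a..b})"
proof (cases "a \<le> b")
  case True
  define g where "g = (\<lambda>t. x (max a (min b t)))"
  have K: "K \<ge> 0" using L by (rule lipschitz_on_nonneg)
  have g_Lip: "norm (g s - g t) \<le> K * \<bar>s - t\<bar>" for s t
  proof -
    have "norm (g s - g t) \<le> K * \<bar>max a (min b s) - max a (min b t)\<bar>"
      unfolding g_def using lipschitz_onD[OF L, of "max a (min b s)" "max a (min b t)"] True
      by (simp add: dist_norm)
    also have "\<dots> \<le> K * \<bar>s - t\<bar>" using K by (intro mult_left_mono) linarith+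
    finally show ?thesis .
  qed
  define F where "F = (\<lambda>i t. g t \<bullet> i + K * t)"
  have comp: "\<bar>g s \<bullet> i - g t \<bullet> i\<bar> \<le> K * \<bar>s - t\<bar>" if "i \<in> Basis" for i s t
    using Basis_le_norm[OF that, of "g s - g t"] g_Lip[of s t] by (simp add: inner_diff_left)
  have neg: "negligible {t. \<not> F i differentiable (at t)}" if i: "i \<in> Basis" for i
  proof (rule differentiable_ae_mono_Lipschitz)
    show "mono (F i)"
    proof (rule monoI)
      fix s t :: real assume "s \<le> t"
      then show "F i s \<le> F i t"
        using comp[OF i, of s t] by (simp add: F_def algebra_simps abs_le_iff)
    qed
    show "(2 * K)-lipschitz_on UNIV (F i)"
    proof (rule lipschitz_onI)
      fix s t :: real
      have "\<bar>F i s - F i t\<bar> \<le> \<bar>g s \<bullet> i - g t \<bullet> i\<bar> + \<bar>K * s - K * t\<bar>"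
        unfolding F_def by linarith
      also have "\<bar>K * s - K * t\<bar> = K * \<bar>s - t\<bar>"
        using K by (simp add: abs_mult flip: right_diff_distrib)
      finally show "dist (F i s) (F i t) \<le> 2 * K * dist s t"
        using comp[OF i, of s t] by (simp add: dist_real_def)
    qed (use K in simp)
  qed
  define N where "N = (\<Union>i\<in>Basis. {t. \<not> F i differentiable (at t)})"
  have "negligible N"
    unfolding N_def using neg by (intro negligible_Union) auto
  then have null: "N \<in> null_sets lebesgue" by (simp add: negligible_iff_null_sets)
  have diff: "x differentiable (at t within {a..b})" if "t \<notin> N" "t \<in> {a..b}" for t
  proof -
    have "g differentiable (at t)"
      unfolding differentiable_componentwise_within[of g t UNIV]
    proof
      fix i :: 'a assume "i \<in> Basis"
      then have "F i differentiable (at t)" using \<open>t \<notin> N\<close> by (auto simp: N_def)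
      then have "(\<lambda>s. F i s - K * s) differentiable (at t)"
        by (intro derivative_intros) auto
      then show "(\<lambda>s. g s \<bullet> i) differentiable (at t)" by (simp add: F_def)
    qed
    then have "g differentiable (at t within {a..b})"
      using differentiable_within_subset by blast
    then show ?thesis
      by (rule differentiable_transform_within[where d = 1]) (use that in \<open>auto simp: g_def max_def min_def\<close>)
  qed
  have "AE t in lebesgue. t \<in> {a..b} \<longrightarrow> x differentiable (at t within {a..b})"
    by (rule AE_I'[OF null]) (use diff in auto)
  then show ?thesis by (subst AE_restrict_space_iff) auto
qed (simp add: AE_restrict_space_iff)

section \<open>Absolute continuity and right difference quotients\<close>

lemma absolutely_continuous_on_interval_Lipschitz:
  assumes L: "K-lipschitz_on {a..b} x"
  shows "absolutely_continuous_on_interval a b x"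
  unfolding absolutely_continuous_on_interval_def
proof (intro allI impI)
  fix \<epsilon> :: real assume "\<epsilon> > 0"
  have K: "K \<ge> 0" using L by (rule lipschitz_on_nonneg)
  show "\<exists>\<rho>>0. \<forall>(N::nat) u v. (\<forall>i<N. a \<le> u i \<and> u i \<le> v i \<and> v i \<le> b) \<longrightarrow>
        disjoint_family_on (\<lambda>i. {u i<..<v i}) {..<N} \<longrightarrow>
        (\<Sum>i<N. v i - u i) < \<rho> \<longrightarrow> (\<Sum>i<N. norm (x (v i) - x (u i))) < \<epsilon>"
  proof (intro exI[of _ "\<epsilon> / (K + 1)"] conjI allI impI)
    show "\<epsilon> / (K + 1) > 0" using \<open>\<epsilon> > 0\<close> K by simp
    fix N :: nat and u v
    assume uv: "\<forall>i<N. a \<le> u i \<and> u i \<le> v i \<and> v i \<le> b" and le: "(\<Sum>i<N. v i - u i) < \<epsilon> / (K + 1)"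
    have "(\<Sum>i<N. norm (x (v i) - x (u i))) \<le> (\<Sum>i<N. K * (v i - u i))"
    proof (rule sum_mono)
      fix i assume "i \<in> {..<N}"
      then have "u i \<in> {a..b}" "v i \<in> {a..b}" "u i \<le> v i" using uv by force+
      then show "norm (x (v i) - x (u i)) \<le> K * (v i - u i)"
        using lipschitz_onD[OF L, of "v i" "u i"] by (simp add: dist_norm)
    qed
    also have "\<dots> = K * (\<Sum>i<N. v i - u i)" by (simp add: sum_distrib_left)
    also have "\<dots> \<le> (K + 1) * (\<Sum>i<N. v i - u i)"
      using uv by (intro mult_right_mono sum_nonneg) auto
    also have "\<dots> < \<epsilon>" using le K by (simp add: field_simps)
    finally show "(\<Sum>i<N. norm (x (v i) - x (u i))) < \<epsilon>" .
  qed
qed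

text \<open>The derivative within \<open>{a..b}\<close> is one-sided at \<open>a\<close>; right
  quotients are available at every \<open>\<tau>\<close> below \<open>b\<close> and are all that the
  passage to the limit uses.\<close>

lemma has_vector_derivative_right_quotient:
  assumes D: "(g has_vector_derivative D) (at \<tau> within {a..b})" and \<tau>: "a \<le> \<tau>" "\<tau> < b"
  shows "((\<lambda>r. (1 / r) *\<^sub>R (g (\<tau> + r) - g \<tau>)) \<longlongrightarrow> D) (at_right 0)"
proof (rule tendstoI)
  fix e :: real assume "e > 0"
  then obtain d where d: "d > 0" and le: "\<And>y. y \<in> {a..b} \<Longrightarrow> norm (y - \<tau>) < d \<Longrightarrow>
      norm (g y - g \<tau> - (y - \<tau>) *\<^sub>R D) \<le> e / 2 * norm (y - \<tau>)"
    using D unfolding has_vector_derivative_def has_derivative_within_alt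
    by (meson half_gt_zero)
  have "dist ((1 / r) *\<^sub>R (g (\<tau> + r) - g \<tau>)) D < e" if r: "0 < r" "r < min d (b - \<tau>)" for r
  proof -
    have "norm (g (\<tau> + r) - g \<tau> - r *\<^sub>R D) \<le> e / 2 * r"
      using le[of "\<tau> + r"] r \<tau> by simp
    moreover have "(1 / r) *\<^sub>R (g (\<tau> + r) - g \<tau>) - D = (1 / r) *\<^sub>R (g (\<tau> + r) - g \<tau> - r *\<^sub>R D)"
      using r by (simp add: algebra_simps)
    ultimately have "dist ((1 / r) *\<^sub>R (g (\<tau> + r) - g \<tau>)) D \<le> e / 2"
      using r by (simp add: dist_norm divide_le_eq)
    with \<open>e > 0\<close> show ?thesis by simp
  qed
  moreover have "0 < min d (b - \<tau>)" using d \<tau> by simp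
  ultimately show "\<forall>\<^sub>F r in at_right 0. dist ((1 / r) *\<^sub>R (g (\<tau> + r) - g \<tau>)) D < e"
    unfolding eventually_at_right_field by blast
qed

section \<open>Minty's theorem and the minimal section\<close>

text \<open>Duality replaces a fixed point argument: the required \<open>x\<close> is \<open>(z - \<zeta>) / 2\<close> for a maximiser
  \<open>(z, \<zeta>, r)\<close> of the dual function \<open>D\<close> below over the convex hull of the points
  \<open>(z\<^sub>i, \<zeta>\<^sub>i, z\<^sub>i \<bullet> \<zeta>\<^sub>i)\<close>, on which monotonicity forces \<open>r \<ge> z \<bullet> \<zeta>\<close> and hence \<open>D \<le> 0\<close>.\<close>

lemma monotone_set_finite:
  fixes G :: "('a::euclidean_space \<times> 'a) set"
  assumes "finite G"
    and mono: "\<And>p q. p \<in> G \<Longrightarrow> q \<in> G \<Longrightarrow> (snd p - snd q) \<bullet> (fst p - fst q) \<ge> 0"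
  shows "\<exists>x. \<forall>p\<in>G. (x + snd p) \<bullet> (fst p - x) \<ge> 0"
proof (cases "G = {}")
  case False
  define \<iota> where "\<iota> = (\<lambda>p::'a\<times>'a. (fst p, snd p, fst p \<bullet> snd p))"
  define H where "H = convex hull (\<iota> ` G)"
  define D where "D = (\<lambda>(z::'a, \<zeta>::'a, r::real). - (1/4) * ((z - \<zeta>) \<bullet> (z - \<zeta>)) - r)"
  have in_half: "H \<subseteq> S" if "convex S" "\<iota> ` G \<subseteq> S" for S
    unfolding H_def using that by (simp add: hull_minimal)
  have half: "convex {p::'a \<times> 'a \<times> real. a \<bullet> fst p + b \<bullet> fst (snd p) + c * snd (snd p) + d \<ge> 0}" for a b c d
  proof -
    have "{p::'a \<times> 'a \<times> real. a \<bullet> fst p + b \<bullet> fst (snd p) + c * snd (snd p) + d \<ge> 0} =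
        {p. (a, b, c) \<bullet> p \<ge> - d}"
      by (auto simp: inner_prod_def)
    then show ?thesis by (simp add: convex_halfspace_ge)
  qed
  \<comment> \<open>The monotonicity inequality is affine in each lifted point separately, so it
    extends from \<open>G\<close> to the hull one argument at a time: here in \<open>p\<close>, and
    in \<open>hull\<close> also in the second argument, where equal arguments give
    \<open>r \<ge> z \<bullet> \<zeta>\<close>.\<close>
  have step: "snd (snd p) - fst p \<bullet> snd q - fst q \<bullet> fst (snd p) + fst q \<bullet> snd q \<ge> 0"
    if "p \<in> H" "q \<in> G" for p q
  proof -
    have "H \<subseteq> {p. (- snd q) \<bullet> fst p + (- fst q) \<bullet> fst (snd p) + 1 * snd (snd p) + fst q \<bullet> snd q \<ge> 0}"
      using mono[OF _ that(2)]
      by (intro in_half half) (auto simp: \<iota>_def algebra_simps inner_commute)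
    then show ?thesis using that by (auto simp: algebra_simps inner_commute)
  qed
  have hull: "snd (snd p) \<ge> fst p \<bullet> fst (snd p)" if "p \<in> H" for p
  proof -
    have "H \<subseteq> {q. (- fst (snd p)) \<bullet> fst q + (- fst p) \<bullet> fst (snd q) + 1 * snd (snd q) + snd (snd p) \<ge> 0}"
      using step[OF that]
      by (intro in_half half) (auto simp: \<iota>_def algebra_simps inner_commute)
    then show ?thesis using that by (auto simp: algebra_simps inner_commute)
  qed
  have "compact H" unfolding H_def using assms(1) by (simp add: finite_imp_compact_convex_hull)
  moreover have "H \<noteq> {}" unfolding H_def using False by simp
  moreover have "continuous_on H D"
    unfolding D_def case_prod_unfold by (intro continuous_intros)
  ultimately obtain p where p: "p \<in> H" and max: "\<And>q. q \<in> H \<Longrightarrow> D q \<le> D p"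
    using continuous_attains_sup by metis
  obtain z \<zeta> r where p_eq: "p = (z, \<zeta>, r)" by (cases p) auto
  define x where "x = (1/2) *\<^sub>R (z - \<zeta>)"
  have D_x: "D p = - (x \<bullet> x) - r"
    unfolding p_eq D_def x_def by simp
  have "(x + snd q) \<bullet> (fst q - x) \<ge> 0" if q: "q \<in> G" for q
  proof -
    define a b c where "a = fst q - z" "b = snd q - \<zeta>" "c = fst q \<bullet> snd q - r"
    let ?k = "x \<bullet> (a - b) + c"
    \<comment> \<open>First variation at the maximiser: moving from \<open>p\<close> toward
      \<open>\<iota> q\<close> cannot increase \<open>D\<close>. After division by \<open>s\<close>,
      letting \<open>s\<close> tend to 0 leaves \<open>?k \<ge> 0\<close>.\<close>
    have "?k + s * ((a - b) \<bullet> (a - b) / 4) \<ge> 0" if s: "0 < s" "s \<le> 1" for s :: real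
    proof -
      have "\<iota> q \<in> H" unfolding H_def using q by (simp add: hull_inc)
      then have "(1 - s) *\<^sub>R p + s *\<^sub>R \<iota> q \<in> H"
        using p s unfolding H_def by (intro convexD_alt) auto
      from max[OF this] have "D ((1 - s) *\<^sub>R p + s *\<^sub>R \<iota> q) \<le> D p" .
      moreover have "(1 - s) *\<^sub>R p + s *\<^sub>R \<iota> q = (z + s *\<^sub>R a, \<zeta> + s *\<^sub>R b, r + s * c)"
        unfolding p_eq \<iota>_def a_b_c_def by (simp add: algebra_simps)
      moreover have "(z + s *\<^sub>R a) - (\<zeta> + s *\<^sub>R b) = 2 *\<^sub>R x + s *\<^sub>R (a - b)"
        unfolding x_def by (simp add: algebra_simps)
      ultimately have "- (1/4) * ((2 *\<^sub>R x + s *\<^sub>R (a - b)) \<bullet> (2 *\<^sub>R x + s *\<^sub>R (a - b))) - (r + s * c)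
          \<le> - (x \<bullet> x) - r"
        unfolding D_x by (simp only: D_def prod.case)
      moreover define X Y where "X = x \<bullet> (a - b)" and "Y = (a - b) \<bullet> (a - b)"
      moreover have "(2 *\<^sub>R x + s *\<^sub>R (a - b)) \<bullet> (2 *\<^sub>R x + s *\<^sub>R (a - b)) =
          4 * (x \<bullet> x) + 4 * (s * X) + s * (s * Y)"
        unfolding X_def Y_def
        by (simp only: inner_add_left inner_add_right inner_scaleR_left inner_scaleR_right
            inner_commute[of "a - b" x]) (simp add: distrib_left)
      ultimately have "s * (X + c + s * (Y / 4)) \<ge> 0"
        by (simp add: algebra_simps)
      then have "s * (?k + s * ((a - b) \<bullet> (a - b) / 4)) \<ge> 0"
        unfolding X_def Y_def .
      with s show ?thesis by (simp add: zero_le_mult_iff)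
    qed
    then have "eventually (\<lambda>s. ?k + s * ((a - b) \<bullet> (a - b) / 4) \<ge> 0) (at_right 0)"
      by (auto simp: eventually_at_right[of 0 1] intro!: exI[of _ 1])
    moreover have "((\<lambda>s. ?k + s * ((a - b) \<bullet> (a - b) / 4)) \<longlongrightarrow> ?k + 0 * ((a - b) \<bullet> (a - b) / 4)) (at_right 0)"
      by (intro tendsto_intros)
    ultimately have k: "?k \<ge> 0"
      using tendsto_lowerbound[of _ "?k + 0 * ((a - b) \<bullet> (a - b) / 4)" "at_right (0::real)" 0]
        trivial_limit_at_right_real by auto
    have "z - \<zeta> = 2 *\<^sub>R x" by (simp add: x_def)
    then have "a - b = fst q - snd q - 2 *\<^sub>R x"
      unfolding a_b_c_def by (simp add: algebra_simps flip: \<open>z - \<zeta> = 2 *\<^sub>R x\<close>)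
    then have "?k = x \<bullet> fst q - x \<bullet> snd q - 2 * (x \<bullet> x) + fst q \<bullet> snd q - r"
      unfolding a_b_c_def(3) by (simp add: inner_diff_right)
    moreover have "(x + snd q) \<bullet> (fst q - x) = x \<bullet> fst q - x \<bullet> x + fst q \<bullet> snd q - x \<bullet> snd q"
      by (simp add: algebra_simps inner_commute)
    \<comment> \<open>The claim equals \<open>?k\<close> plus this quantity, which is at least the
      squared norm of \<open>(z + \<zeta>) / 2\<close> because
      \<open>r \<ge> z \<bullet> \<zeta>\<close>.\<close>
    moreover have "x \<bullet> x + r \<ge> 0"
    proof -
      have "x \<bullet> x + z \<bullet> \<zeta> = ((1/2) *\<^sub>R (z + \<zeta>)) \<bullet> ((1/2) *\<^sub>R (z + \<zeta>))"
        unfolding x_def by (simp add: algebra_simps inner_commute)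
      then have "x \<bullet> x + z \<bullet> \<zeta> \<ge> 0" by (metis inner_ge_zero)
      then show ?thesis using hull[OF p] by (simp add: p_eq)
    qed
    ultimately show ?thesis using k by linarith
  qed
  then show ?thesis by blast
qed simp

text \<open>The conclusion says that \<open>(x, - x)\<close> is monotonically related to all of
  \<open>G\<close>, a case of the Debrunner-Flor lemma. For one \<open>p\<close> the admissible
  \<open>x\<close> form the closed ball with diameter from \<open>- snd p\<close> to
  \<open>fst p\<close>, so compactness reduces the claim to finite subsets.\<close>

lemma monotone_set_extension:
  fixes G :: "('a::euclidean_space \<times> 'a) set"
  assumes mono: "\<And>p q. p \<in> G \<Longrightarrow> q \<in> G \<Longrightarrow> (snd p - snd q) \<bullet> (fst p - fst q) \<ge> 0"
  shows "\<exists>x. \<forall>p\<in>G. (x + snd p) \<bullet> (fst p - x) \<ge> 0"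
proof -
  define K where "K = (\<lambda>p::'a\<times>'a. {x. (x + snd p) \<bullet> (fst p - x) \<ge> 0})"
  have K_ball: "K p = cball ((1/2) *\<^sub>R (fst p - snd p)) (norm (fst p + snd p) / 2)" for p
  proof -
    have "(x + snd p) \<bullet> (fst p - x) \<ge> 0 \<longleftrightarrow> dist ((1/2) *\<^sub>R (fst p - snd p)) x \<le> norm (fst p + snd p) / 2" for x
    proof -
      have "(x + snd p) \<bullet> (fst p - x) = (norm (fst p + snd p) / 2)\<^sup>2 - (dist ((1/2) *\<^sub>R (fst p - snd p)) x)\<^sup>2"
        unfolding dist_norm power_divide power2_norm_eq_inner
        by (simp add: algebra_simps inner_commute) (simp add: field_simps)
      then show ?thesis by (simp add: power_mono_iff)
    qed
    then show ?thesis unfolding K_def cball_def by (rule Collect_cong)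
  qed
  have "\<Inter>(K ` G) \<noteq> {}"
  proof (rule compact_fip_Heine_Borel)
    fix T assume "T \<in> K ` G"
    then show "compact T" by (auto simp: K_ball)
  next
    fix \<F> assume "finite \<F>" "\<F> \<subseteq> K ` G"
    then obtain G' where G': "G' \<subseteq> G" "finite G'" "\<F> = K ` G'"
      by (meson finite_subset_image)
    then obtain x where "\<forall>p\<in>G'. (x + snd p) \<bullet> (fst p - x) \<ge> 0"
      using monotone_set_finite[of G'] mono by blast
    then show "\<Inter>\<F> \<noteq> {}" using G' by (auto simp: K_def)
  qed
  then show ?thesis by (auto simp: K_def)
qed

lemma monotone_opD:
  assumes "monotone_op F" "\<eta> \<in> F z" "\<zeta> \<in> F w"
  shows "(\<eta> - \<zeta>) \<bullet> (z - w) \<ge> 0"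
  using assms unfolding monotone_op_def by blast

text \<open>A point monotonically related to the whole graph can be added to it without losing
  monotonicity. Maximality enters only in this form.\<close>

lemma maximal_monotone_op_memI:
  assumes F: "maximal_monotone_op F"
    and rel: "\<And>w \<zeta>. \<zeta> \<in> F w \<Longrightarrow> (\<eta> - \<zeta>) \<bullet> (z - w) \<ge> 0"
  shows "\<eta> \<in> F z"
proof -
  define G where "G = F(z := insert \<eta> (F z))"
  have mF: "monotone_op F" using F by (simp add: maximal_monotone_op_def)
  have rel': "(\<zeta> - \<eta>) \<bullet> (w - z) \<ge> 0" if "\<zeta> \<in> F w" for w \<zeta>
    using rel[OF that] by (metis inner_minus_left inner_minus_right minus_diff_eq minus_minus)
  have "monotone_op G"
    unfolding monotone_op_def
  proof (intro allI ballI)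
    fix u v \<alpha> \<beta> assume "\<alpha> \<in> G u" "\<beta> \<in> G v"
    then have "\<alpha> \<in> F u \<or> \<alpha> = \<eta> \<and> u = z" "\<beta> \<in> F v \<or> \<beta> = \<eta> \<and> v = z"
      by (auto simp: G_def split: if_splits)
    then show "(\<alpha> - \<beta>) \<bullet> (u - v) \<ge> 0"
      using rel rel' monotone_opD[OF mF] by auto
  qed
  moreover have "F w \<subseteq> G w" for w by (auto simp: G_def)
  ultimately have "G = F" using F by (simp add: maximal_monotone_op_def)
  then show ?thesis by (metis G_def fun_upd_same insertI1)
qed

text \<open>Scaling the graph by \<open>h\<close> and shifting it by \<open>y\<close> turns the
  relation of \<open>(x, - x)\<close> to \<open>G\<close> into the relation of
  \<open>(1 / h) *\<^sub>R (y - x)\<close> at \<open>x\<close> to the graph of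
  \<open>F\<close>.\<close>

lemma Minty:
  assumes F: "maximal_monotone_op F" and h: "h > 0"
  shows "\<exists>x. (1 / h) *\<^sub>R (y - x) \<in> F x"
proof -
  define G where "G = {(z, h *\<^sub>R \<zeta> - y) | z \<zeta>. \<zeta> \<in> F z}"
  have mF: "monotone_op F" using F by (simp add: maximal_monotone_op_def)
  have "(snd p - snd q) \<bullet> (fst p - fst q) \<ge> 0" if pq: "p \<in> G" "q \<in> G" for p q
  proof -
    obtain z \<zeta> w \<xi> where "p = (z, h *\<^sub>R \<zeta> - y)" "q = (w, h *\<^sub>R \<xi> - y)" "\<zeta> \<in> F z" "\<xi> \<in> F w"
      using pq by (auto simp: G_def)
    moreover from this have "(\<zeta> - \<xi>) \<bullet> (z - w) \<ge> 0" using monotone_opD[OF mF] by blast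
    ultimately show ?thesis
      using h by (simp flip: scaleR_diff_right)
  qed
  then obtain x where x: "\<forall>p\<in>G. (x + snd p) \<bullet> (fst p - x) \<ge> 0"
    using monotone_set_extension by blast
  have "(1 / h) *\<^sub>R (y - x) \<in> F x"
  proof (rule maximal_monotone_op_memI[OF F])
    fix w \<zeta> assume "\<zeta> \<in> F w"
    then have "(x + (h *\<^sub>R \<zeta> - y)) \<bullet> (w - x) \<ge> 0"
      using x by (fastforce simp: G_def)
    moreover have "((1 / h) *\<^sub>R (y - x) - \<zeta>) \<bullet> (x - w) = (1 / h) * ((x + (h *\<^sub>R \<zeta> - y)) \<bullet> (w - x))"
      using h by (simp add: algebra_simps)
    ultimately show "((1 / h) *\<^sub>R (y - x) - \<zeta>) \<bullet> (x - w) \<ge> 0"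
      using h by simp
  qed
  then show ?thesis ..
qed

text \<open>Maximality makes \<open>F z\<close> the intersection of the half-spaces cut out by the
  monotonicity inequalities, hence closed and convex; the \<open>THE\<close> therefore picks the
  unique point nearest to 0.\<close>

lemma min_section_mem:
  assumes F: "maximal_monotone_op F" and z: "z \<in> op_dom F"
  shows "min_section F z \<in> F z"
proof -
  have mF: "monotone_op F" using F by (simp add: maximal_monotone_op_def)
  have eq: "F z = (\<Inter>(w, \<zeta>)\<in>{(w, \<zeta>). \<zeta> \<in> F w}. {\<eta>. (z - w) \<bullet> \<eta> \<ge> (z - w) \<bullet> \<zeta>})" (is "_ = ?R")
  proof (intro subset_antisym subsetI)
    fix \<eta> assume "\<eta> \<in> F z"
    then have "(z - w) \<bullet> \<eta> \<ge> (z - w) \<bullet> \<zeta>" if "\<zeta> \<in> F w" for w \<zeta>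
      using monotone_opD[OF mF _ that, of \<eta> z] by (simp add: inner_diff_left inner_diff_right inner_commute)
    then show "\<eta> \<in> ?R" by auto
  next
    fix \<eta> assume "\<eta> \<in> ?R"
    have "(\<eta> - \<zeta>) \<bullet> (z - w) \<ge> 0" if "\<zeta> \<in> F w" for w \<zeta>
    proof -
      have "(z - w) \<bullet> \<zeta> \<le> (z - w) \<bullet> \<eta>" using \<open>\<eta> \<in> ?R\<close> that by auto
      moreover have "(\<eta> - \<zeta>) \<bullet> (z - w) = (z - w) \<bullet> \<eta> - (z - w) \<bullet> \<zeta>"
        by (metis inner_commute inner_diff_right)
      ultimately show ?thesis by simp
    qed
    then show "\<eta> \<in> F z" by (rule maximal_monotone_op_memI[OF F])
  qed
  have closed: "closed (F z)"
    unfolding eq by (intro closed_INT ballI) (simp add: case_prod_unfold closed_halfspace_ge)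
  have convex: "convex (F z)"
    unfolding eq by (intro convex_INT) (simp add: case_prod_unfold convex_halfspace_ge)
  have ne: "F z \<noteq> {}" using z by (simp add: op_dom_def)
  have "\<exists>!\<eta>. \<eta> \<in> F z \<and> (\<forall>\<zeta>\<in>F z. norm \<eta> \<le> norm \<zeta>)"
  proof (rule ex_ex1I)
    show "\<exists>\<eta>. \<eta> \<in> F z \<and> (\<forall>\<zeta>\<in>F z. norm \<eta> \<le> norm \<zeta>)"
      using closest_point_exists[OF closed ne, of 0] by (auto simp: dist_0_norm)
    show "\<eta> = \<xi>" if "\<eta> \<in> F z \<and> (\<forall>\<zeta>\<in>F z. norm \<eta> \<le> norm \<zeta>)" "\<xi> \<in> F z \<and> (\<forall>\<zeta>\<in>F z. norm \<xi> \<le> norm \<zeta>)" for \<eta> \<xi>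
      using that by (intro any_closest_point_unique[OF convex closed, of \<eta> \<xi> 0]) (auto simp: dist_0_norm)
  qed
  from theI'[OF this] show ?thesis by (simp add: min_section_def)
qed

section \<open>The implicit Euler scheme\<close>

text \<open>For \<open>c = 0\<close> this is monotonicity across the two graphs; \<open>c\<close>
  thus bounds the defect of monotonicity when the operator changes.\<close>

lemma vladimirov_disD:
  assumes "vladimirov_dis F E \<le> ereal c" "\<eta> \<in> F z" "\<zeta> \<in> E w"
  shows "(\<eta> - \<zeta>) \<bullet> (w - z) \<le> c * (1 + norm \<eta> + norm \<zeta>)"
proof -
  have "ereal (((\<eta> - \<zeta>) \<bullet> (w - z)) / (1 + norm \<eta> + norm \<zeta>)) \<le> vladimirov_dis F E"
    unfolding vladimirov_dis_def using assms(2,3)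
    by (intro Sup_upper CollectI exI[of _ z] exI[of _ w] exI[of _ \<eta>] exI[of _ \<zeta>])
      (auto simp: op_dom_def)
  then have "((\<eta> - \<zeta>) \<bullet> (w - z)) / (1 + norm \<eta> + norm \<zeta>) \<le> c"
    using assms(1) order_trans by fastforce
  moreover have "1 + norm \<eta> + norm \<zeta> > 0"
    by (intro add_pos_nonneg) auto
  ultimately show ?thesis by (simp add: divide_le_eq)
qed

text \<open>The hypothesis reads \<open>s * (s - k - a) \<le> a * (1 + k)\<close>. The
  arithmetic-geometric mean replaces the square root of the right side by
  \<open>\<delta> * a + (1 + k) / (4 * \<delta>)\<close>, which keeps the coefficient of
  \<open>a\<close>, the carrier of the previous speed, as close to 1 as desired.\<close>

lemma quadratic_root_bound:
  fixes s a k \<delta> :: real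
  assumes "a \<ge> 0" "k \<ge> 0" "\<delta> > 0" and le: "s\<^sup>2 \<le> k * s + a * (1 + k + s)"
  shows "s \<le> k + (1 + \<delta>) * a + (1 + k) / (4 * \<delta>)"
proof (rule ccontr)
  assume contr: "\<not> ?thesis"
  define b where "b = \<delta> * a + (1 + k) / (4 * \<delta>)"
  have "b > 0" unfolding b_def using assms by (intro add_nonneg_pos) auto
  have "0 \<le> (\<delta> * a - (1 + k) / (4 * \<delta>))\<^sup>2" by simp
  also have "\<dots> = b\<^sup>2 - 4 * (\<delta> * a) * ((1 + k) / (4 * \<delta>))"
    unfolding b_def power2_eq_square by algebra
  also have "4 * (\<delta> * a) * ((1 + k) / (4 * \<delta>)) = a * (1 + k)" using assms by simp
  finally have b2: "a * (1 + k) \<le> b * b" by (simp add: power2_eq_square)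
  have s: "s - k - a > b" using contr by (simp add: b_def algebra_simps)
  then have "b * b < s * (s - k - a)"
    using \<open>b > 0\<close> assms by (intro mult_strict_mono) auto
  with b2 le show False by (simp add: algebra_simps power2_eq_square)
qed

text \<open>Here \<open>w\<close> is the resolvent of \<open>y\<close> without drift. Comparing \<open>u\<close> with \<open>w\<close> first, rather than
  estimating \<open>u - y\<close> directly, is what gives \<open>norm g\<close> the coefficient 1 required by \<^const>\<open>c1_const\<close>.\<close>

lemma resolvent_step_bound:
  assumes F: "monotone_op F" and w: "(1 / h) *\<^sub>R (y - w) \<in> F w"
    and u: "(1 / h) *\<^sub>R (y + h *\<^sub>R g - u) \<in> F u"
    and \<xi>: "\<xi> \<in> E y" and dis: "vladimirov_dis F E \<le> ereal (h * a)"
    and pos: "h > 0" "a \<ge> 0" "\<delta> > 0"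
  shows "norm (u - y) \<le> h * (norm g + (norm \<xi> + (1 + \<delta>) * a + (1 + norm \<xi>) / (4 * \<delta>)))"
proof -
  \<comment> \<open>Monotonicity of \<open>F\<close> at \<open>u\<close> and \<open>w\<close> makes
    the resolvent nonexpansive, so the drift moves it by at most \<open>h * norm g\<close>.\<close>
  have "(1 / h) *\<^sub>R (y + h *\<^sub>R g - u) - (1 / h) *\<^sub>R (y - w) = (1 / h) *\<^sub>R (h *\<^sub>R g - (u - w))"
    by (simp add: algebra_simps)
  with monotone_opD[OF F u w] have "0 \<le> (1 / h) * ((h *\<^sub>R g - (u - w)) \<bullet> (u - w))"
    by (metis inner_scaleR_left)
  then have "0 \<le> (h *\<^sub>R g - (u - w)) \<bullet> (u - w)"
    using pos by (simp add: zero_le_divide_iff)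
  then have "norm (u - w) * norm (u - w) \<le> (h *\<^sub>R g) \<bullet> (u - w)"
    by (simp add: inner_diff_left flip: power2_norm_eq_inner power2_eq_square)
  also have "\<dots> \<le> norm (h *\<^sub>R g) * norm (u - w)" by (rule norm_cauchy_schwarz)
  finally have uw: "norm (u - w) \<le> h * norm g"
    using pos by (cases "u = w") auto
  \<comment> \<open>Since \<open>y - w\<close> is \<open>h\<close> times \<open>\<eta>\<close>,
    testing the pseudo-distance on \<open>\<eta>\<close> at \<open>w\<close> and
    \<open>\<xi>\<close> at \<open>y\<close> yields a quadratic inequality in
    \<open>norm \<eta>\<close> from which \<open>h\<close> cancels.\<close>
  define \<eta> where "\<eta> = (1 / h) *\<^sub>R (y - w)"
  have yw: "y - w = h *\<^sub>R \<eta>" using pos by (simp add: \<eta>_def)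
  have "(\<eta> - \<xi>) \<bullet> (y - w) \<le> h * a * (1 + norm \<eta> + norm \<xi>)"
    using vladimirov_disD[OF dis _ \<xi>] w \<eta>_def by blast
  then have "h * ((\<eta> - \<xi>) \<bullet> \<eta>) \<le> h * (a * (1 + norm \<eta> + norm \<xi>))"
    by (simp add: yw)
  then have "(\<eta> - \<xi>) \<bullet> \<eta> \<le> a * (1 + norm \<eta> + norm \<xi>)" using pos by simp
  moreover have "\<xi> \<bullet> \<eta> \<le> norm \<xi> * norm \<eta>" by (rule norm_cauchy_schwarz)
  ultimately have "(norm \<eta>)\<^sup>2 \<le> norm \<xi> * norm \<eta> + a * (1 + norm \<xi> + norm \<eta>)"
    by (simp add: inner_diff_left power2_norm_eq_inner add_ac)
  then have "norm \<eta> \<le> norm \<xi> + (1 + \<delta>) * a + (1 + norm \<xi>) / (4 * \<delta>)"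
    using pos by (intro quadratic_root_bound) auto
  then have "h * norm \<eta> \<le> h * (norm \<xi> + (1 + \<delta>) * a + (1 + norm \<xi>) / (4 * \<delta>))"
    using pos by (intro mult_left_mono) auto
  moreover have "norm (u - y) \<le> norm (u - w) + norm (y - w)"
    using norm_triangle_ineq[of "u - w" "w - y"] by (simp add: norm_minus_commute)
  moreover have "norm (y - w) = h * norm \<eta>" using pos by (simp add: yw)
  ultimately show ?thesis using uw by (simp add: distrib_left)
qed

section \<open>Standing hypotheses and the uniform discrete speed bound\<close>

locale state_dependent_inclusion =
  fixes T L\<^sub>1 L\<^sub>2 c\<^sub>A c\<^sub>f \<delta> :: real
    and A :: "real \<Rightarrow> real ^ 'n \<Rightarrow> ('n::finite) operator"
    and f :: "real \<Rightarrow> real ^ 'n \<Rightarrow> real ^ 'n"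
  assumes maximal: "\<And>t x. t \<in> {0..T} \<Longrightarrow> maximal_monotone_op (A t x)"
    and L1: "L\<^sub>1 \<ge> 0" and L2: "0 \<le> L\<^sub>2"
    and dis: "\<And>t s x y. t \<in> {0..T} \<Longrightarrow> s \<in> {0..T} \<Longrightarrow>
           vladimirov_dis (A t x) (A s y) \<le> ereal (L\<^sub>1 * \<bar>t - s\<bar> + L\<^sub>2 * norm (x - y))"
    and cA: "c\<^sub>A > 0"
    and min_section_le: "\<And>t x y. t \<in> {0..T} \<Longrightarrow> y \<in> op_dom (A t x) \<Longrightarrow>
           norm (min_section (A t x) y) \<le> c\<^sub>A * (1 + norm x + norm y)"
    and f_cont: "continuous_on ({0..T} \<times> UNIV) (\<lambda>(t, x). f t x)"
    and cf: "c\<^sub>f > 0"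
    and f_le: "\<And>t x. t \<in> {0..T} \<Longrightarrow> norm (f t x) \<le> c\<^sub>f * (1 + norm x)"
    and \<delta>: "\<delta> > 0" "(1 + \<delta>) * L\<^sub>2 < 1"
begin

text \<open>The fixed point of the map sending \<open>v\<close> to
  \<open>(1 + \<delta>) * L\<^sub>2 * v\<close> plus \<open>c1_const\<close>: a speed bound relative
  to the size of the state that reproduces itself from step to step.\<close>

definition C :: real where
  "C = c1_const \<delta> L\<^sub>1 c\<^sub>A c\<^sub>f / (1 - (1 + \<delta>) * L\<^sub>2)"

text \<open>\<open>1 + 2 * norm x0\<close> is the starting value of
  \<open>1 + norm (X (i - 1)) + norm (X i)\<close>. The rate is \<open>2 * C\<close> because both
  norms can grow at \<open>C\<close> times the bound on that quantity.\<close>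

definition speed :: "real ^ 'n \<Rightarrow> real \<Rightarrow> real" where
  "speed x0 r = C * (1 + 2 * norm x0) * exp (2 * C * r)"

lemma c1_pos: "c1_const \<delta> L\<^sub>1 c\<^sub>A c\<^sub>f > 0"
proof -
  have "0 < (1 + (4 * \<delta> + 1) * c\<^sub>A) / (4 * \<delta>)"
    using \<delta>(1) cA by (intro divide_pos_pos) (auto intro!: add_pos_pos)
  moreover have "0 \<le> (1 + \<delta>) * L\<^sub>1" using \<delta>(1) L1 by simp
  ultimately show ?thesis unfolding c1_const_def using cf by linarith
qed

lemma C_pos: "C > 0"
  unfolding C_def using c1_pos \<delta>(2) by (intro divide_pos_pos) auto

lemma C_fixpoint: "(1 + \<delta>) * L\<^sub>2 * C + c1_const \<delta> L\<^sub>1 c\<^sub>A c\<^sub>f = C"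
proof -
  have "C * (1 - (1 + \<delta>) * L\<^sub>2) = c1_const \<delta> L\<^sub>1 c\<^sub>A c\<^sub>f"
    unfolding C_def using \<delta> by simp
  then show ?thesis by (simp add: algebra_simps)
qed

lemma speed_mono: "r \<le> r' \<Longrightarrow> speed x0 r \<le> speed x0 r'"
  unfolding speed_def using C_pos by (intro mult_left_mono) auto

lemma speed_nonneg: "speed x0 r \<ge> 0"
  unfolding speed_def using C_pos by (intro mult_nonneg_nonneg) auto

text \<open>The factor \<open>C\<close> in front of \<open>norm x0\<close> is absorbed by enlarging
  the exponent: \<open>C \<le> exp (4 * C)\<close>.\<close>

lemma speed_1_le_m_bound: "speed x0 1 \<le> m_bound \<delta> L\<^sub>1 L\<^sub>2 c\<^sub>A c\<^sub>f x0"
proof -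
  have "C \<le> exp (4 * C)" using exp_ge_add_one_self[of "4 * C"] C_pos by linarith
  then have "C * exp (2 * C) \<le> exp (4 * C) * exp (2 * C)" by (intro mult_right_mono) auto
  also have "\<dots> = exp (6 * C)" by (simp flip: exp_add)
  finally have 1: "2 * norm x0 * (C * exp (2 * C)) \<le> 2 * norm x0 * exp (6 * C)"
    by (intro mult_left_mono) auto
  have "exp (2 * C) \<le> exp (6 * C)" "0 \<le> exp (6 * C)" using C_pos by auto
  then have 2: "C * exp (2 * C) \<le> 2 * C * exp (6 * C)"
    using C_pos by (intro mult_mono) auto
  have "m_bound \<delta> L\<^sub>1 L\<^sub>2 c\<^sub>A c\<^sub>f x0 = (2 * norm x0 + 2 * C) * exp (6 * C)"
    by (simp add: m_bound_def C_def)
  with 1 2 show ?thesis by (simp add: speed_def algebra_simps)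
qed

text \<open>\<open>y'\<close> is the node before \<open>y\<close>, at which the operator that
  produced \<open>y\<close> is frozen, so the minimal section is taken in \<open>A s y'\<close>.
  Because \<open>C\<close> is a fixed point, the old and the new increment obey the same bound,
  which makes the estimate iterable.\<close>

lemma discrete_step:
  assumes ts: "s \<in> {0..T}" "s + h \<in> {0..T}" and h: "h > 0"
    and y: "y \<in> op_dom (A s y')"
    and u: "(1 / h) *\<^sub>R (y + h *\<^sub>R f s y - u) \<in> A (s + h) y u"
    and Y: "1 + norm y' + norm y \<le> Y" "norm (y - y') \<le> h * (C * Y)"
  shows "norm (u - y) \<le> h * (C * Y)"
proof -
  let ?W = "1 + norm y' + norm y"
  define \<xi> where "\<xi> = min_section (A s y') y"
  have \<xi>: "\<xi> \<in> A s y' y" unfolding \<xi>_def using maximal[OF ts(1)] y by (rule min_section_mem)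
  have \<xi>_le: "norm \<xi> \<le> c\<^sub>A * ?W" unfolding \<xi>_def using min_section_le[OF ts(1) y] .
  \<comment> \<open>\<open>h * a\<close> is the assumed bound on the pseudo-distance of the two
    consecutive operators, so \<open>a\<close> contains the previous speed multiplied by
    \<open>L\<^sub>2\<close>.\<close>
  define a where "a = L\<^sub>1 + L\<^sub>2 * norm (y - y') / h"
  obtain w where w: "(1 / h) *\<^sub>R (y - w) \<in> A (s + h) y w"
    using Minty[OF maximal[OF ts(2)] h] by blast
  have "vladimirov_dis (A (s + h) y) (A s y') \<le> ereal (h * a)"
    using dis[OF ts(2,1), of y y'] h by (simp add: a_def distrib_left mult.commute)
  moreover have "a \<ge> 0" unfolding a_def using L1 L2 h by simp
  ultimately have "norm (u - y) \<le> h * (norm (f s y) + (norm \<xi> + (1 + \<delta>) * a + (1 + norm \<xi>) / (4 * \<delta>)))"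
    using maximal[OF ts(2)] h \<delta> w u \<xi>
    by (intro resolvent_step_bound[where F = "A (s + h) y" and E = "A s y'" and w = w])
      (auto simp: maximal_monotone_op_def)
  also have "\<dots> \<le> h * (C * Y)"
  proof (rule mult_left_mono)
    have W: "?W \<ge> 1" by simp
    have "c\<^sub>f * (1 + norm y) \<le> c\<^sub>f * ?W"
      using cf by (intro mult_left_mono) auto
    then have "norm (f s y) \<le> c\<^sub>f * ?W"
      using f_le[OF ts(1), of y] by linarith
    moreover have "(1 + \<delta>) * a \<le> (1 + \<delta>) * L\<^sub>1 * ?W + (1 + \<delta>) * L\<^sub>2 * (C * Y)"
    proof -
      have "norm (y - y') / h \<le> C * Y" using Y(2) h by (simp add: divide_le_eq mult.commute)
      then have "L\<^sub>2 * (norm (y - y') / h) \<le> L\<^sub>2 * (C * Y)" using L2 by (rule mult_left_mono)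
      moreover have "L\<^sub>1 * 1 \<le> L\<^sub>1 * ?W" using L1 W by (intro mult_left_mono) auto
      ultimately have "a \<le> L\<^sub>1 * ?W + L\<^sub>2 * (C * Y)" by (simp add: a_def)
      then have "(1 + \<delta>) * a \<le> (1 + \<delta>) * (L\<^sub>1 * ?W + L\<^sub>2 * (C * Y))"
        using \<delta> by (intro mult_left_mono) auto
      then show ?thesis by (simp only: distrib_left mult.assoc)
    qed
    moreover have "(1 + norm \<xi>) / (4 * \<delta>) \<le> (1 * ?W + c\<^sub>A * ?W) / (4 * \<delta>)"
      using add_mono[OF W \<xi>_le] \<delta> by (intro divide_right_mono) simp_all
    ultimately have "norm (f s y) + (norm \<xi> + (1 + \<delta>) * a + (1 + norm \<xi>) / (4 * \<delta>))
        \<le> c\<^sub>f * ?W + (c\<^sub>A * ?W + ((1 + \<delta>) * L\<^sub>1 * ?W + (1 + \<delta>) * L\<^sub>2 * (C * Y))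
          + (1 * ?W + c\<^sub>A * ?W) / (4 * \<delta>))"
      using \<xi>_le by linarith
    \<comment> \<open>\<open>c1_const\<close> arises here: \<open>c\<^sub>A\<close> from
      \<open>norm \<xi>\<close> and \<open>(1 + c\<^sub>A) / (4 * \<delta>)\<close> from the
      quadratic bound are put over one denominator.\<close>
    also have "\<dots> = (c\<^sub>f + (1 + (4 * \<delta> + 1) * c\<^sub>A) / (4 * \<delta>) + (1 + \<delta>) * L\<^sub>1) * ?W + (1 + \<delta>) * L\<^sub>2 * (C * Y)"
    proof -
      have "(c\<^sub>f + (1 + (4 * \<delta> + 1) * c\<^sub>A) / (4 * \<delta>) + M) * V = c\<^sub>f * V + (c\<^sub>A * V + M * V + (1 * V + c\<^sub>A * V) / (4 * \<delta>))"
        for M V using \<delta>(1) by (simp add: field_simps)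
      then show ?thesis by simp
    qed
    also have "\<dots> \<le> c1_const \<delta> L\<^sub>1 c\<^sub>A c\<^sub>f * Y + (1 + \<delta>) * L\<^sub>2 * (C * Y)"
      using Y(1) c1_pos unfolding c1_const_def by (intro add_right_mono mult_left_mono) auto
    also have "\<dots> = C * Y"
      using C_fixpoint by (metis add.commute distrib_right mult.assoc)
    finally show "norm (f s y) + (norm \<xi> + (1 + \<delta>) * a + (1 + norm \<xi>) / (4 * \<delta>)) \<le> C * Y" .
  qed (use h in simp)
  finally show ?thesis .
qed

text \<open>For \<open>i = 0\<close> the truncated \<open>X (i - 1)\<close> in the proof is \<open>X 0\<close>, so \<open>x0 \<in> op_dom (A t0 x0)\<close>
  starts the recursion with zero initial speed.\<close>

lemma discrete_scheme:
  assumes t0: "t0 \<in> {0..T}" and x0: "x0 \<in> op_dom (A t0 x0)" and h: "h > 0"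
    and N: "t0 + real N * h \<le> T"
  shows "\<exists>X. X 0 = x0 \<and> (\<forall>i<N.
      norm (X (Suc i) - X i) \<le> h * speed x0 (real i * h) \<and>
      (1 / h) *\<^sub>R (X i + h *\<^sub>R f (t0 + real i * h) (X i) - X (Suc i))
        \<in> A (t0 + real (Suc i) * h) (X i) (X (Suc i)))"
proof -
  define J where "J = (\<lambda>i y. SOME u. (1 / h) *\<^sub>R (y + h *\<^sub>R f (t0 + real i * h) y - u)
        \<in> A (t0 + real (Suc i) * h) y u)"
  define X where "X = rec_nat x0 J"
  have X0: "X 0 = x0" and XS: "X (Suc i) = J i (X i)" for i
    by (simp_all add: X_def)
  have tT: "t0 + real i * h \<in> {0..T}" if "i \<le> N" for i
  proof -
    have "real i * h \<le> real N * h" using that h by (intro mult_right_mono) auto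
    moreover have "0 \<le> real i * h" using h by simp
    ultimately show ?thesis using t0 N unfolding atLeastAtMost_iff by linarith
  qed
  have incl: "(1 / h) *\<^sub>R (X i + h *\<^sub>R f (t0 + real i * h) (X i) - X (Suc i))
        \<in> A (t0 + real (Suc i) * h) (X i) (X (Suc i))" if "i < N" for i
    unfolding XS J_def by (rule someI_ex, rule Minty[OF maximal[OF tT] h]) (use that in simp)
  \<comment> \<open>\<open>Y\<close> is to dominate \<open>1 + 2 * norm\<close> of two neighbouring
    nodes separately, hence also the mean \<open>1 + norm (X (i - 1)) + norm (X i)\<close>. An
    increment of size \<open>h * (C * Y i)\<close> enters doubled, whence the ratio
    \<open>1 + 2 * (h * C)\<close>.\<close>
  define Y where "Y = (\<lambda>i. (1 + 2 * norm x0) * (1 + 2 * (h * C)) ^ i)"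
  have hC: "h * C > 0" using h C_pos by simp
  have Y_Suc: "Y (Suc i) = Y i + 2 * (h * (C * Y i))" for i
    by (simp add: Y_def algebra_simps)
  have Y_pos: "Y i > 0" for i
    unfolding Y_def using hC by (intro mult_pos_pos zero_less_power) (auto intro: add_pos_nonneg)
  have Y_le: "Y i \<le> Y (Suc i)" for i
    unfolding Y_Suc using Y_pos[of i] h C_pos by simp
  have incr: "norm (X (Suc i) - X i) \<le> h * (C * Y i)"
    if i: "i < N" and dom: "X i \<in> op_dom (A (t0 + real i * h) (X (i - 1)))"
      and Yi: "1 + 2 * norm (X i) \<le> Y i" "1 + 2 * norm (X (i - 1)) \<le> Y i"
      and d: "norm (X i - X (i - 1)) \<le> h * (C * Y i)" for i
  proof -
    have tS: "t0 + real (Suc i) * h = t0 + real i * h + h" by (simp add: algebra_simps)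
    have "1 + norm (X (i - 1)) + norm (X i) \<le> Y i" using Yi by linarith
    moreover have "t0 + real i * h \<in> {0..T}" "t0 + real i * h + h \<in> {0..T}"
      using tT[of i] tT[of "Suc i"] i unfolding tS by auto
    ultimately show ?thesis
      using discrete_step[OF _ _ h dom _ _ d] incl[OF i] unfolding tS by blast
  qed
  \<comment> \<open>The last increment is compared with \<open>Y i\<close> rather than with the
    \<open>Y (i - 1)\<close> that bounded it originally, since \<open>discrete_step\<close> wants
    one \<open>Y\<close> for both increments.\<close>
  have inv: "X i \<in> op_dom (A (t0 + real i * h) (X (i - 1))) \<and> 1 + 2 * norm (X i) \<le> Y i \<and>
      1 + 2 * norm (X (i - 1)) \<le> Y i \<and> norm (X i - X (i - 1)) \<le> h * (C * Y i)" if "i \<le> N" for i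
    using that
  proof (induction i)
    case 0
    then show ?case using x0 Y_pos[of 0] h C_pos by (simp add: X0 Y_def)
  next
    case (Suc i)
    then have IH: "X i \<in> op_dom (A (t0 + real i * h) (X (i - 1)))" "1 + 2 * norm (X i) \<le> Y i"
      "1 + 2 * norm (X (i - 1)) \<le> Y i" "norm (X i - X (i - 1)) \<le> h * (C * Y i)" and i: "i < N"
      by auto
    have step: "norm (X (Suc i) - X i) \<le> h * (C * Y i)"
      using IH incr[OF i] by simp
    have "norm (X (Suc i)) \<le> norm (X i) + norm (X (Suc i) - X i)"
      by (rule norm_triangle_sub)
    then have "1 + 2 * norm (X (Suc i)) \<le> Y (Suc i)"
      using IH step by (simp add: Y_Suc)
    moreover have "h * (C * Y i) \<le> h * (C * Y (Suc i))"
      using Y_le h C_pos by (intro mult_left_mono) auto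
    moreover have "X (Suc i) \<in> op_dom (A (t0 + real (Suc i) * h) (X i))"
      using incl[OF i] by (auto simp: op_dom_def)
    ultimately show ?case using step IH Y_le[of i] by auto
  qed
  have "norm (X (Suc i) - X i) \<le> h * speed x0 (real i * h)" if i: "i < N" for i
  proof -
    have "norm (X (Suc i) - X i) \<le> h * (C * Y i)"
      using inv[of i] incr[OF i] i by simp
    also have "\<dots> \<le> h * (C * ((1 + 2 * norm x0) * exp (2 * C * (real i * h))))"
    proof -
      have "(1 + 2 * (h * C)) ^ i \<le> exp (2 * (h * C)) ^ i"
        using hC exp_ge_add_one_self[of "2 * (h * C)"] by (intro power_mono) auto
      also have "\<dots> = exp (2 * C * (real i * h))"
        by (simp add: mult_ac flip: exp_of_nat_mult)
      finally show ?thesis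
        unfolding Y_def using h C_pos by (intro mult_left_mono) auto
    qed
    also have "\<dots> = h * speed x0 (real i * h)" by (simp add: speed_def)
    finally show ?thesis .
  qed
  with X0 incl show ?thesis by blast
qed

end

section \<open>Piecewise linear interpolation\<close>

text \<open>With this representation increments of the interpolant are combinations of the increments of
  \<open>X\<close> with nonnegative weights of total mass \<open>(t - s) / h\<close>.\<close>

definition ramp :: "real \<Rightarrow> real" where
  "ramp u = max 0 (min 1 u)"

definition interp :: "real \<Rightarrow> real \<Rightarrow> nat \<Rightarrow> (nat \<Rightarrow> 'a::real_normed_vector) \<Rightarrow> real \<Rightarrow> 'a" where
  "interp t0 h N X t = X 0 + (\<Sum>i<N. ramp ((t - t0) / h - real i) *\<^sub>R (X (Suc i) - X i))"

lemma sum_ramp: "(\<Sum>i<N. ramp (u - real i)) = max 0 (min (real N) u)"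
proof (induction N)
  case (Suc N)
  have "max 0 (min (real N) u) + ramp (u - real N) = max 0 (min (real N + 1) u)"
    unfolding ramp_def by (cases "u \<le> real N"; cases "u \<le> real N + 1"; cases "0 \<le> u") simp_all
  then show ?case using Suc by (simp add: add.commute)
qed simp

lemma interp_node:
  assumes "h > 0" "k \<le> N"
  shows "interp t0 h N X (t0 + real k * h) = X k"
proof -
  have "ramp (real k - real i) *\<^sub>R (X (Suc i) - X i) = (if i < k then X (Suc i) - X i else 0)" for i
    by (auto simp: ramp_def)
  then have "interp t0 h N X (t0 + real k * h) = X 0 + (\<Sum>i<N. if i < k then X (Suc i) - X i else 0)"
    using assms(1) by (simp add: interp_def)
  also have "(\<Sum>i<N. if i < k then X (Suc i) - X i else 0) = (\<Sum>i<k. X (Suc i) - X i)"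
    using assms(2) by (intro sum.mono_neutral_cong_right) auto
  finally show ?thesis by (simp add: sum_lessThan_telescope)
qed

text \<open>The support condition localises: only steps whose cell meets \<open>{s<..<t}\<close>
  carry weight, so estimates on those steps alone control the increment.\<close>

lemma interp_diff:
  assumes "h > 0" "t0 \<le> s" "s \<le> t" "t \<le> t0 + real N * h"
  obtains w where "\<And>i. 0 \<le> w i"
    "\<And>i. w i \<noteq> 0 \<Longrightarrow> t0 + real i * h < t \<and> s < t0 + real (Suc i) * h"
    "(\<Sum>i<N. w i) = (t - s) / h"
    "interp t0 h N X t - interp t0 h N X s = (\<Sum>i<N. w i *\<^sub>R (X (Suc i) - X i))"
proof
  define w where "w = (\<lambda>i. ramp ((t - t0) / h - real i) - ramp ((s - t0) / h - real i))"
  have st: "(s - t0) / h \<le> (t - t0) / h" "0 \<le> (s - t0) / h" "(t - t0) / h \<le> real N"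
    using assms by (auto simp: field_simps)
  show "0 \<le> w i" for i
    using st by (auto simp: w_def ramp_def)
  show "t0 + real i * h < t \<and> s < t0 + real (Suc i) * h" if "w i \<noteq> 0" for i
  proof -
    have "real i < (t - t0) / h" "(s - t0) / h < real i + 1"
      using that st unfolding w_def ramp_def by linarith+
    then show ?thesis using assms(1) by (simp add: field_simps)
  qed
  show "(\<Sum>i<N. w i) = (t - s) / h"
    using st by (simp add: w_def sum_subtractf sum_ramp field_simps)
      (simp add: diff_divide_distrib)
  show "interp t0 h N X t - interp t0 h N X s = (\<Sum>i<N. w i *\<^sub>R (X (Suc i) - X i))"
    by (simp add: interp_def w_def scaleR_diff_left sum_subtractf)
qed

lemma interp_Lipschitz:
  assumes "h > 0" "t0 \<le> s" "s \<le> t" "t \<le> t0 + real N * h"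
    and X: "\<And>i. i < N \<Longrightarrow> t0 + real i * h < t \<Longrightarrow> norm (X (Suc i) - X i) \<le> h * \<kappa>"
  shows "norm (interp t0 h N X t - interp t0 h N X s) \<le> \<kappa> * (t - s)"
proof -
  obtain w where w: "\<And>i. 0 \<le> w i" "\<And>i. w i \<noteq> 0 \<Longrightarrow> t0 + real i * h < t \<and> s < t0 + real (Suc i) * h"
    "(\<Sum>i<N. w i) = (t - s) / h"
    "interp t0 h N X t - interp t0 h N X s = (\<Sum>i<N. w i *\<^sub>R (X (Suc i) - X i))"
    using interp_diff[OF assms(1-4)] by blast
  have "norm (\<Sum>i<N. w i *\<^sub>R (X (Suc i) - X i)) \<le> (\<Sum>i<N. w i * (h * \<kappa>))"
  proof (rule sum_norm_le)
    fix i assume "i \<in> {..<N}"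
    then show "norm (w i *\<^sub>R (X (Suc i) - X i)) \<le> w i * (h * \<kappa>)"
      using w(1)[of i] w(2)[of i] X[of i] by (cases "w i = 0") (auto intro!: mult_left_mono)
  qed
  also have "\<dots> = \<kappa> * (t - s)"
    using assms(1) w(3) by (simp flip: sum_distrib_right)
  finally show ?thesis by (simp add: w(4))
qed

lemma interp_inner_le:
  fixes X :: "nat \<Rightarrow> 'a::real_inner"
  assumes "h > 0" "t0 \<le> s" "s \<le> t" "t \<le> t0 + real N * h"
    and X: "\<And>i. i < N \<Longrightarrow> t0 + real i * h < t \<Longrightarrow> s < t0 + real (Suc i) * h \<Longrightarrow>
        (X (Suc i) - X i) \<bullet> e \<le> h * \<kappa>"
  shows "(interp t0 h N X t - interp t0 h N X s) \<bullet> e \<le> \<kappa> * (t - s)"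
proof -
  obtain w where w: "\<And>i. 0 \<le> w i" "\<And>i. w i \<noteq> 0 \<Longrightarrow> t0 + real i * h < t \<and> s < t0 + real (Suc i) * h"
    "(\<Sum>i<N. w i) = (t - s) / h"
    "interp t0 h N X t - interp t0 h N X s = (\<Sum>i<N. w i *\<^sub>R (X (Suc i) - X i))"
    using interp_diff[OF assms(1-4)] by blast
  have "(\<Sum>i<N. w i *\<^sub>R (X (Suc i) - X i)) \<bullet> e \<le> (\<Sum>i<N. w i * (h * \<kappa>))"
    unfolding inner_sum_left
  proof (rule sum_mono)
    fix i assume "i \<in> {..<N}"
    then show "(w i *\<^sub>R (X (Suc i) - X i)) \<bullet> e \<le> w i * (h * \<kappa>)"
      using w(1)[of i] w(2)[of i] X[of i] by (cases "w i = 0") (auto intro!: mult_left_mono)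
  qed
  also have "\<dots> = \<kappa> * (t - s)"
    using assms(1) w(3) by (simp flip: sum_distrib_right)
  finally show ?thesis by (simp add: w(4))
qed

context state_dependent_inclusion
begin

section \<open>Passage to the limit\<close>

text \<open>\<open>d\<close> and \<open>e\<close> measure how far the time, the two states and the
  drift of one step are from their values at \<open>(\<tau>, y)\<close>. The pseudo-distance
  compares \<open>A s' u\<close> with \<open>A \<tau> y\<close> quantitatively and so takes the
  place of a closed graph argument.\<close>

lemma step_inner_le:
  assumes \<tau>: "\<tau> \<in> {0..T}" and \<zeta>: "\<zeta> \<in> A \<tau> y z" and s': "s' \<in> {0..T}" and h: "h > 0"
    and incl: "(1 / h) *\<^sub>R (u + h *\<^sub>R p - u') \<in> A s' u u'"
    and M: "norm (u' - u) \<le> h * M" and B: "norm p \<le> B" and p: "norm (p - f \<tau> y) \<le> e"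
    and d: "\<bar>s' - \<tau>\<bar> \<le> d" "norm (u - y) \<le> d" "norm (u' - y) \<le> d"
  shows "(u' - u) \<bullet> (y - z) \<le> h * ((f \<tau> y - \<zeta>) \<bullet> (y - z) + e * norm (y - z) +
      d * ((L\<^sub>1 + L\<^sub>2) * (1 + (B + M) + norm \<zeta>) + (B + M + norm \<zeta>)))"
proof -
  define v where "v = (1 / h) *\<^sub>R (u' - u)"
  define \<eta> where "\<eta> = p - v"
  have \<eta>: "\<eta> \<in> A s' u u'"
    using incl h by (simp add: \<eta>_def v_def algebra_simps)
  have "norm v \<le> M" using M h by (simp add: v_def divide_le_eq mult.commute)
  then have \<eta>_le: "norm \<eta> \<le> B + M"
    using norm_triangle_ineq4[of p v] B by (simp add: \<eta>_def)
  have d0: "d \<ge> 0" using d by linarith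
  have "(\<eta> - \<zeta>) \<bullet> (z - u') \<le> (L\<^sub>1 * \<bar>s' - \<tau>\<bar> + L\<^sub>2 * norm (u - y)) * (1 + norm \<eta> + norm \<zeta>)"
    by (rule vladimirov_disD[OF dis[OF s' \<tau>] \<eta> \<zeta>])
  also have "\<dots> \<le> (L\<^sub>1 * d + L\<^sub>2 * d) * (1 + (B + M) + norm \<zeta>)"
    using d L1 L2 \<eta>_le d0 by (intro mult_mono add_mono mult_left_mono) auto
  finally have 1: "(\<eta> - \<zeta>) \<bullet> (z - u') \<le> (L\<^sub>1 * d + L\<^sub>2 * d) * (1 + (B + M) + norm \<zeta>)" .
  have "(\<eta> - \<zeta>) \<bullet> (u' - y) \<le> norm (\<eta> - \<zeta>) * norm (u' - y)" by (rule norm_cauchy_schwarz)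
  also have "\<dots> \<le> (B + M + norm \<zeta>) * d"
    using d \<eta>_le norm_triangle_ineq4[of \<eta> \<zeta>] d0
      order_trans[OF norm_ge_zero \<eta>_le] by (intro mult_mono) auto
  finally have 2: "(\<eta> - \<zeta>) \<bullet> (u' - y) \<le> (B + M + norm \<zeta>) * d" .
  have "(p - f \<tau> y) \<bullet> (y - z) \<le> norm (p - f \<tau> y) * norm (y - z)" by (rule norm_cauchy_schwarz)
  also have "\<dots> \<le> e * norm (y - z)" using p by (intro mult_right_mono) auto
  finally have 3: "(p - f \<tau> y) \<bullet> (y - z) \<le> e * norm (y - z)" .
  have "v \<bullet> (y - z) = (f \<tau> y - \<zeta>) \<bullet> (y - z) + (p - f \<tau> y) \<bullet> (y - z)
      + (\<eta> - \<zeta>) \<bullet> (z - u') + (\<eta> - \<zeta>) \<bullet> (u' - y)"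
    by (simp add: \<eta>_def inner_diff_left inner_diff_right)
  with 1 2 3 have "v \<bullet> (y - z) \<le> (f \<tau> y - \<zeta>) \<bullet> (y - z) + e * norm (y - z) +
      d * ((L\<^sub>1 + L\<^sub>2) * (1 + (B + M) + norm \<zeta>) + (B + M + norm \<zeta>))"
    by (simp add: algebra_simps)
  then have "h * (v \<bullet> (y - z)) \<le> h * ((f \<tau> y - \<zeta>) \<bullet> (y - z) + e * norm (y - z) +
      d * ((L\<^sub>1 + L\<^sub>2) * (1 + (B + M) + norm \<zeta>) + (B + M + norm \<zeta>)))"
    using h by (intro mult_left_mono) auto
  moreover have "(u' - u) \<bullet> (y - z) = h * (v \<bullet> (y - z))" using h by (simp add: v_def)
  ultimately show ?thesis by simp
qed

text \<open>For fixed \<open>(z, \<zeta>)\<close> in the graph at \<open>(\<tau>, g \<tau>)\<close> the inequality of \<open>step_inner_le\<close> is linear in the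
  increment, so it can be summed over \<open>{\<tau>..\<tau> + r}\<close> before letting \<open>n \<rightarrow> \<infinity>\<close> and then \<open>r \<rightarrow> 0\<close>: only pointwise
  convergence of the interpolants is used, not weak convergence of their derivatives.\<close>

lemma limit_inclusion:
  fixes X :: "nat \<Rightarrow> nat \<Rightarrow> real ^ 'n"
  assumes t0: "0 \<le> t0" and \<tau>: "t0 \<le> \<tau>" "\<tau> < T" and K: "K \<ge> 0"
    and h: "\<And>n. h n > 0" "\<And>n. t0 + real (N n) * h n = T" "h \<longlonglongrightarrow> 0"
    and speed: "\<And>n i. i < N n \<Longrightarrow> norm (X n (Suc i) - X n i) \<le> h n * K"
    and incl: "\<And>n i. i < N n \<Longrightarrow>
      (1 / h n) *\<^sub>R (X n i + h n *\<^sub>R f (t0 + real i * h n) (X n i) - X n (Suc i))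
        \<in> A (t0 + real (Suc i) * h n) (X n i) (X n (Suc i))"
    and lim: "\<And>t. t \<in> {t0..T} \<Longrightarrow> (\<lambda>n. interp t0 (h n) (N n) (X n) t) \<longlonglongrightarrow> g t"
    and D: "((\<lambda>r. (1 / r) *\<^sub>R (g (\<tau> + r) - g \<tau>)) \<longlongrightarrow> D) (at_right 0)"
  shows "f \<tau> (g \<tau>) - D \<in> A \<tau> (g \<tau>) (g \<tau>)"
proof (rule maximal_monotone_op_memI[where F = "A \<tau> (g \<tau>)"])
  let ?\<Phi> = "\<lambda>n. interp t0 (h n) (N n) (X n)"
  define y where "y = g \<tau>"
  have \<tau>T: "\<tau> \<in> {0..T}" using t0 \<tau> by simp
  show "maximal_monotone_op (A \<tau> (g \<tau>))" by (rule maximal[OF \<tau>T])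
  fix z \<zeta> assume "\<zeta> \<in> A \<tau> (g \<tau>) z"
  then have \<zeta>: "\<zeta> \<in> A \<tau> y z" by (simp add: y_def)
  define c where "c = (f \<tau> y - \<zeta>) \<bullet> (y - z)"
  have \<Phi>_Lip: "norm (?\<Phi> n t - ?\<Phi> n s) \<le> K * \<bar>t - s\<bar>" if "s \<in> {t0..T}" "t \<in> {t0..T}" for n s t
  proof (cases "s \<le> t")
    case True
    then show ?thesis
      using interp_Lipschitz[of "h n" t0 s t "N n" "X n" K] h speed that by auto
  next
    case False
    then show ?thesis
      using interp_Lipschitz[of "h n" t0 t s "N n" "X n" K] h speed that
      by (auto simp: norm_minus_commute)
  qed
  have node: "t0 + real i * h n \<in> {t0..T}" "?\<Phi> n (t0 + real i * h n) = X n i" if "i \<le> N n" for n i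
  proof -
    have "real i * h n \<le> real (N n) * h n" using that h(1)[of n] by (intro mult_right_mono) auto
    moreover have "0 \<le> real i * h n" using h(1)[of n] by simp
    ultimately show "t0 + real i * h n \<in> {t0..T}" using h(2)[of n] by auto
    show "?\<Phi> n (t0 + real i * h n) = X n i" using interp_node[OF h(1) that] .
  qed
  have "D \<bullet> (y - z) \<le> c + \<epsilon>" if "\<epsilon> > 0" for \<epsilon>
  proof -
    \<comment> \<open>Half of \<open>\<epsilon>\<close> pays for the drift error through
      \<open>e\<close>, the other half for the remaining errors \<open>d * Q\<close>, where
      \<open>Q\<close> is the factor of \<open>d\<close> in \<open>step_inner_le\<close>. The
      summand 1 keeps the divisor positive when \<open>y = z\<close>.\<close>
    define W where "W = norm (y - z) + 1"
    have W: "W > 0" unfolding W_def by (rule add_nonneg_pos) auto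
    define e where "e = \<epsilon> / (2 * W)"
    have e: "e > 0" using \<open>\<epsilon> > 0\<close> W by (simp add: e_def)
    have "e * norm (y - z) \<le> e * W" using e by (intro mult_left_mono) (auto simp: W_def)
    also have "\<dots> = \<epsilon> / 2" using W by (simp add: e_def)
    finally have e_le: "e * norm (y - z) \<le> \<epsilon> / 2" .
    define B where "B = norm (f \<tau> y) + e"
    define Q where "Q = (L\<^sub>1 + L\<^sub>2) * (1 + (B + K) + norm \<zeta>) + (B + K + norm \<zeta>)"
    have "B \<ge> 0" using e by (simp add: B_def)
    then have "Q \<ge> 0" unfolding Q_def using K L1 L2 by (intro add_nonneg_nonneg mult_nonneg_nonneg) auto
    obtain d1 where d1: "d1 > 0" "\<And>s u. s \<in> {0..T} \<Longrightarrow> dist (s, u) (\<tau>, y) < d1 \<Longrightarrow> dist (f s u) (f \<tau> y) < e"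
    proof -
      have "\<exists>d>0. \<forall>p\<in>{0..T} \<times> UNIV. dist p (\<tau>, y) < d \<longrightarrow>
          dist ((\<lambda>(t, x). f t x) p) ((\<lambda>(t, x). f t x) (\<tau>, y)) < e"
        using f_cont \<tau>T e unfolding continuous_on_iff by blast
      then show thesis using that by fastforce
    qed
    define d where "d = min (d1 / 4) (\<epsilon> / (2 * (Q + 1)))"
    have d: "d > 0" using d1 \<open>\<epsilon> > 0\<close> \<open>Q \<ge> 0\<close> by (simp add: d_def)
    have dQ: "d * Q \<le> \<epsilon> / 2"
    proof -
      define P where "P = Q + 1"
      have P: "P > 0" "Q \<le> P" using \<open>Q \<ge> 0\<close> by (simp_all add: P_def)
      have "d * Q \<le> \<epsilon> / (2 * P) * P"
        using \<open>Q \<ge> 0\<close> \<open>\<epsilon> > 0\<close> P by (intro mult_mono) (auto simp: d_def P_def)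
      also have "\<dots> = \<epsilon> / 2" using P by simp
      finally show ?thesis .
    qed
    have f_near: "norm (f s u - f \<tau> y) \<le> e" if "s \<in> {0..T}" "\<bar>s - \<tau>\<bar> \<le> d" "norm (u - y) \<le> d" for s u
    proof -
      have "dist (s, u) (\<tau>, y) \<le> dist s \<tau> + dist u y"
        unfolding dist_Pair_Pair by (rule sqrt_sum_squares_le_sum) auto
      also have "\<dots> \<le> 2 * d" using that by (simp add: dist_norm)
      also have "\<dots> < d1" using d1(1) by (auto simp: d_def)
      finally show ?thesis using d1(2)[OF that(1)] by (simp add: dist_norm less_imp_le)
    qed
    \<comment> \<open>Both nodes of a step meeting \<open>{\<tau>..\<tau> + r}\<close> lie within
      \<open>r + h n\<close>, at most \<open>2 * r0\<close>, of \<open>\<tau>\<close>. Half of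
      \<open>d\<close> covers their Lipschitz displacement, the other half the distance from the
      interpolant at \<open>\<tau>\<close> to \<open>y\<close>.\<close>
    define r0 where "r0 = d / (4 * (K + 1))"
    have r0: "r0 > 0" using d K by (simp add: r0_def)
    have Kr0: "K * (r0 + r0) \<le> d / 2" "r0 + r0 \<le> d / 2"
    proof -
      have "K + 1 \<noteq> 0" using K by simp
      then have r0K: "r0 * (K + 1) = d / 4"
        unfolding r0_def by (metis nonzero_eq_divide_eq divide_divide_eq_left)
      have "0 \<le> r0 * K" using r0 K by simp
      with r0K r0 show "K * (r0 + r0) \<le> d / 2" "r0 + r0 \<le> d / 2" by (simp_all add: algebra_simps)
    qed
    have slope: "(g (\<tau> + r) - g \<tau>) \<bullet> (y - z) \<le> (c + \<epsilon>) * r" if r: "0 < r" "r \<le> r0" "\<tau> + r \<le> T" for r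
    proof -
      have "\<forall>\<^sub>F n in sequentially. h n < r0"
        using h(3) r0 by (rule order_tendstoD)
      moreover have "\<forall>\<^sub>F n in sequentially. dist (?\<Phi> n \<tau>) y < d / 2"
        using lim[of \<tau>] \<tau> d unfolding y_def by (intro tendstoD) auto
      ultimately have "\<forall>\<^sub>F n in sequentially. (?\<Phi> n (\<tau> + r) - ?\<Phi> n \<tau>) \<bullet> (y - z) \<le> (c + \<epsilon>) * r"
      proof eventually_elim
        fix n assume hn: "h n < r0" and close: "dist (?\<Phi> n \<tau>) y < d / 2"
        have near: "norm (X n i - y) \<le> d" "\<bar>t0 + real i * h n - \<tau>\<bar> \<le> d"
          if i: "i \<le> N n" and t: "\<bar>t0 + real i * h n - \<tau>\<bar> \<le> r0 + r0" for i
        proof -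
          have "norm (X n i - ?\<Phi> n \<tau>) \<le> K * \<bar>t0 + real i * h n - \<tau>\<bar>"
            using \<Phi>_Lip[of \<tau> "t0 + real i * h n" n] node[OF i] \<tau> by auto
          also have "\<dots> \<le> K * (r0 + r0)" using t K by (intro mult_left_mono) auto
          finally have "norm (X n i - ?\<Phi> n \<tau>) \<le> d / 2" using Kr0 by linarith
          then show "norm (X n i - y) \<le> d"
            using close norm_triangle_ineq[of "X n i - ?\<Phi> n \<tau>" "?\<Phi> n \<tau> - y"] by (simp add: dist_norm)
          show "\<bar>t0 + real i * h n - \<tau>\<bar> \<le> d" using t Kr0 d by linarith
        qed
        have "(?\<Phi> n (\<tau> + r) - ?\<Phi> n \<tau>) \<bullet> (y - z) \<le> (c + \<epsilon>) * (\<tau> + r - \<tau>)"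
        proof (rule interp_inner_le)
          show "h n > 0" "t0 \<le> \<tau>" "\<tau> \<le> \<tau> + r" "\<tau> + r \<le> t0 + real (N n) * h n"
            using h(1,2)[of n] \<tau> r by auto
          fix i assume i: "i < N n" "t0 + real i * h n < \<tau> + r" "\<tau> < t0 + real (Suc i) * h n"
          have tS: "t0 + real (Suc i) * h n = t0 + real i * h n + h n" by (simp add: algebra_simps)
          have near1: "norm (X n i - y) \<le> d" "\<bar>t0 + real i * h n - \<tau>\<bar> \<le> d"
            using near[of i] i r hn h(1)[of n] unfolding tS by linarith+
          have near2: "norm (X n (Suc i) - y) \<le> d" "\<bar>t0 + real (Suc i) * h n - \<tau>\<bar> \<le> d"
            using near[of "Suc i"] i r hn h(1)[of n] unfolding tS by linarith+
          have T1: "t0 + real i * h n \<in> {0..T}" "t0 + real (Suc i) * h n \<in> {0..T}"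
            using node(1)[of i n] node(1)[of "Suc i" n] i(1) t0 by auto
          let ?p = "f (t0 + real i * h n) (X n i)"
          have p: "norm (?p - f \<tau> y) \<le> e" by (rule f_near[OF T1(1) near1(2,1)])
          then have "norm ?p \<le> B"
            using norm_triangle_sub[of ?p "f \<tau> y"] by (simp add: B_def)
          from step_inner_le[OF \<tau>T \<zeta> T1(2) h(1) incl[OF i(1)] speed[OF i(1)] this p near2(2) near1(1) near2(1)]
          have "(X n (Suc i) - X n i) \<bullet> (y - z) \<le> h n * (c + e * norm (y - z) + d * Q)"
            by (simp add: c_def Q_def)
          also have "\<dots> \<le> h n * (c + \<epsilon>)"
            using e_le dQ h(1)[of n] by (intro mult_left_mono) auto
          finally show "(X n (Suc i) - X n i) \<bullet> (y - z) \<le> h n * (c + \<epsilon>)" .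
        qed
        then show "(?\<Phi> n (\<tau> + r) - ?\<Phi> n \<tau>) \<bullet> (y - z) \<le> (c + \<epsilon>) * r" by simp
      qed
      moreover have "(\<lambda>n. (?\<Phi> n (\<tau> + r) - ?\<Phi> n \<tau>) \<bullet> (y - z)) \<longlonglongrightarrow> (g (\<tau> + r) - g \<tau>) \<bullet> (y - z)"
        using \<tau> r by (intro tendsto_intros lim) auto
      ultimately show ?thesis
        using tendsto_upperbound[OF _ _ trivial_limit_sequentially] by blast
    qed
    have "\<forall>\<^sub>F r in at_right 0. ((1 / r) *\<^sub>R (g (\<tau> + r) - g \<tau>)) \<bullet> (y - z) \<le> c + \<epsilon>"
      unfolding eventually_at_right_field
    proof (intro exI conjI allI impI)
      show "0 < min r0 (T - \<tau>)" using r0 \<tau> by simp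
      fix r :: real assume "0 < r" "r < min r0 (T - \<tau>)"
      with slope[of r] show "((1 / r) *\<^sub>R (g (\<tau> + r) - g \<tau>)) \<bullet> (y - z) \<le> c + \<epsilon>"
        by (simp add: divide_le_eq)
    qed
    moreover have "((\<lambda>r. ((1 / r) *\<^sub>R (g (\<tau> + r) - g \<tau>)) \<bullet> (y - z)) \<longlongrightarrow> D \<bullet> (y - z)) (at_right 0)"
      by (intro tendsto_intros D)
    ultimately show ?thesis
      using tendsto_upperbound trivial_limit_at_right_real by blast
  qed
  then have "D \<bullet> (y - z) \<le> c" by (rule field_le_epsilon)
  then show "(f \<tau> (g \<tau>) - D - \<zeta>) \<bullet> (g \<tau> - z) \<ge> 0"
    by (simp add: c_def y_def inner_diff_left)
qed

end

section \<open>Compactness of the interpolants and existence of a solution\<close>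

context state_dependent_inclusion
begin

lemma solution_exists_nondegenerate:
  assumes t0: "0 \<le> t0" "t0 < T" and x0: "x0 \<in> op_dom (A t0 x0)"
  shows "\<exists>x. is_solution A f t0 T x0 x \<and>
      (AE t in lebesgue_on {t0..T}. norm (vector_derivative x (at t within {t0..T})) \<le> speed x0 (t - t0)) \<and>
      (\<forall>t\<in>{t0..T}. norm (x t - x0) \<le> speed x0 (t - t0) * (t - t0))"
proof -
  define N where "N = (\<lambda>n::nat. Suc n)"
  define h where "h = (\<lambda>n. (T - t0) / real (N n))"
  define K where "K = speed x0 (T - t0)"
  have K: "K \<ge> 0" by (simp add: K_def speed_nonneg)
  have h: "h n > 0" "t0 + real (N n) * h n = T" for n
    using t0 by (simp_all add: h_def N_def)
  have h_lim: "h \<longlonglongrightarrow> 0"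
    unfolding h_def N_def by (rule LIMSEQ_Suc[OF lim_const_over_n])
  have "\<exists>X. X 0 = x0 \<and> (\<forall>i<N n.
      norm (X (Suc i) - X i) \<le> h n * speed x0 (real i * h n) \<and>
      (1 / h n) *\<^sub>R (X i + h n *\<^sub>R f (t0 + real i * h n) (X i) - X (Suc i))
        \<in> A (t0 + real (Suc i) * h n) (X i) (X (Suc i)))" for n
    using t0 x0 h[of n] by (intro discrete_scheme) auto
  then obtain X where X: "\<And>n. X n 0 = x0" "\<And>n i. i < N n \<Longrightarrow>
      norm (X n (Suc i) - X n i) \<le> h n * speed x0 (real i * h n) \<and>
      (1 / h n) *\<^sub>R (X n i + h n *\<^sub>R f (t0 + real i * h n) (X n i) - X n (Suc i))
        \<in> A (t0 + real (Suc i) * h n) (X n i) (X n (Suc i))"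
    by metis
  define \<Phi> where "\<Phi> = (\<lambda>n. interp t0 (h n) (N n) (X n))"
  have \<Phi>_t0: "\<Phi> n t0 = x0" for n
    using interp_node[OF h(1), of 0 "N n" t0 n "X n"] X(1) by (simp add: \<Phi>_def)
  \<comment> \<open>Only steps that start before \<open>t\<close> contribute, and the speed bound
    increases in time, so its value at \<open>t\<close> serves for the whole increment. Keeping this
    time dependence beside the global \<open>K\<close> makes the final bound on the first unit
    interval independent of \<open>T\<close>.\<close>
  have \<Phi>_speed: "norm (\<Phi> n t - \<Phi> n s) \<le> speed x0 (t - t0) * (t - s)"
    if st: "t0 \<le> s" "s \<le> t" "t \<le> T" for n s t
    unfolding \<Phi>_def
  proof (rule interp_Lipschitz)
    show "h n > 0" "t0 \<le> s" "s \<le> t" "t \<le> t0 + real (N n) * h n" using h[of n] st by auto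
    fix i assume "i < N n" "t0 + real i * h n < t"
    then show "norm (X n (Suc i) - X n i) \<le> h n * speed x0 (t - t0)"
      using X(2)[of i n] speed_mono[of "real i * h n" "t - t0" x0] h(1)[of n]
      by (smt (verit) mult_left_mono)
  qed
  have speed_K: "speed x0 (t - t0) \<le> K" if "t \<le> T" for t
    unfolding K_def using that by (intro speed_mono) simp
  have \<Phi>_Lip: "norm (\<Phi> n t - \<Phi> n s) \<le> K * \<bar>t - s\<bar>" if st: "s \<in> {t0..T}" "t \<in> {t0..T}" for n s t
  proof -
    have *: "norm (\<Phi> n t - \<Phi> n s) \<le> K * (t - s)" if "t0 \<le> s" "s \<le> t" "t \<le> T" for s t
      using \<Phi>_speed[OF that] speed_K[OF that(3)] that(2)
      by (meson diff_ge_0_iff_ge mult_right_mono order_trans)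
    show ?thesis
      using *[of s t] *[of t s] st by (cases "s \<le> t") (auto simp: norm_minus_commute)
  qed
  obtain x k where x: "continuous_on {t0..T} x" "strict_mono (k :: nat \<Rightarrow> nat)"
      "\<And>e. 0 < e \<Longrightarrow> \<exists>N. \<forall>n t. n \<ge> N \<and> t \<in> {t0..T} \<longrightarrow> norm (\<Phi> (k n) t - x t) < e"
  proof (rule Arzela_Ascoli[of "{t0..T}" \<Phi> "norm x0 + K * (T - t0)"])
    show "norm (\<Phi> n t) \<le> norm x0 + K * (T - t0)" if t: "t \<in> {t0..T}" for n t
    proof -
      have "norm (\<Phi> n t - x0) \<le> K * \<bar>t - t0\<bar>"
        using \<Phi>_Lip[of t0 t n] t \<Phi>_t0 by auto
      also have "\<dots> \<le> K * (T - t0)" using t K by (intro mult_left_mono) auto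
      finally show ?thesis using norm_triangle_sub[of "\<Phi> n t" x0] by linarith
    qed
    show "\<exists>d>0. \<forall>n s. s \<in> {t0..T} \<and> norm (t - s) < d \<longrightarrow> norm (\<Phi> n t - \<Phi> n s) < e"
      if t: "t \<in> {t0..T}" and "0 < e" for t e
    proof (intro exI[of _ "e / (K + 1)"] conjI allI impI)
      show "0 < e / (K + 1)" using K \<open>0 < e\<close> by simp
      fix n s assume s: "s \<in> {t0..T} \<and> norm (t - s) < e / (K + 1)"
      then have "norm (\<Phi> n t - \<Phi> n s) \<le> K * \<bar>t - s\<bar>" using \<Phi>_Lip t by blast
      also have "\<dots> \<le> (K + 1) * \<bar>t - s\<bar>" by (intro mult_right_mono) auto
      also have "\<dots> < e" using s K by (simp add: field_simps)
      finally show "norm (\<Phi> n t - \<Phi> n s) < e" .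
    qed
  qed auto
  have lim: "(\<lambda>n. \<Phi> (k n) t) \<longlonglongrightarrow> x t" if "t \<in> {t0..T}" for t
    using x(3) that unfolding LIMSEQ_iff by blast
  have "(\<lambda>n. \<Phi> (k n) t0) \<longlonglongrightarrow> x0" by (simp add: \<Phi>_t0)
  with lim[of t0] t0 have x_t0: "x t0 = x0" using LIMSEQ_unique by auto
  have x_speed: "norm (x t - x s) \<le> speed x0 (t - t0) * (t - s)" if st: "t0 \<le> s" "s \<le> t" "t \<le> T" for s t
  proof -
    have "(\<lambda>n. norm (\<Phi> (k n) t - \<Phi> (k n) s)) \<longlonglongrightarrow> norm (x t - x s)"
      using st by (intro tendsto_intros lim) auto
    then show ?thesis
      by (rule LIMSEQ_le_const2) (use \<Phi>_speed[OF st] in blast)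
  qed
  have Lip: "K-lipschitz_on {t0..T} x"
  proof (rule lipschitz_onI)
    fix s t assume st: "s \<in> {t0..T}" "t \<in> {t0..T}"
    have "(\<lambda>n. norm (\<Phi> (k n) s - \<Phi> (k n) t)) \<longlonglongrightarrow> norm (x s - x t)"
      using st by (intro tendsto_intros lim) auto
    then show "dist (x s) (x t) \<le> K * dist s t"
      unfolding dist_norm real_norm_def by (rule LIMSEQ_le_const2) (use \<Phi>_Lip[OF st(2,1)] in blast)
  qed (rule K)
  \<comment> \<open>\<open>T\<close> is discarded as a null set because the curve has no right
    difference quotient within the interval there.\<close>
  have ae: "AE t in lebesgue_on {t0..T}. x differentiable (at t within {t0..T}) \<and> t < T"
  proof -
    have "AE t in lebesgue. t \<noteq> T"
      by (rule AE_I'[of "{T}"]) auto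
    then have "AE t in lebesgue_on {t0..T}. t < T"
      by (subst AE_restrict_space_iff) (auto elim!: eventually_mono)
    then show ?thesis using ae_differentiable_Lipschitz[OF Lip] by (rule AE_conjI[rotated])
  qed
  have right_quotient: "((\<lambda>r. (1 / r) *\<^sub>R (x (t + r) - x t)) \<longlongrightarrow> vector_derivative x (at t within {t0..T})) (at_right 0)"
    if "x differentiable (at t within {t0..T})" "t0 \<le> t" "t < T" for t
    using that by (intro has_vector_derivative_right_quotient) (auto simp: vector_derivative_works)
  have "is_solution A f t0 T x0 x"
    unfolding is_solution_def
  proof (intro conjI x_t0)
    show "absolutely_continuous_on_interval t0 T x"
      using Lip by (rule absolutely_continuous_on_interval_Lipschitz)
    show "AE t in lebesgue_on {t0..T}. x differentiable (at t within {t0..T}) \<and>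
        vector_derivative x (at t within {t0..T}) \<in> {f t (x t) - \<eta> |\<eta>. \<eta> \<in> A t (x t) (x t)}"
      using ae
    proof (rule lebesgue_on_mono)
      fix t assume d: "x differentiable (at t within {t0..T}) \<and> t < T" and t: "t \<in> {t0..T}"
      let ?D = "vector_derivative x (at t within {t0..T})"
      have "f t (x t) - ?D \<in> A t (x t) (x t)"
      proof (rule limit_inclusion[where h = "h \<circ> k" and N = "N \<circ> k" and X = "X \<circ> k" and K = K and \<tau> = t])
        show "(h \<circ> k) \<longlonglongrightarrow> 0" using h_lim x(2) by (rule LIMSEQ_subseq_LIMSEQ)
        show "((\<lambda>r. (1 / r) *\<^sub>R (x (t + r) - x t)) \<longlongrightarrow> ?D) (at_right 0)"
          using right_quotient d t by auto
        show "norm ((X \<circ> k) n (Suc i) - (X \<circ> k) n i) \<le> (h \<circ> k) n * K" if i: "i < (N \<circ> k) n" for n i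
        proof -
          have "real i * h (k n) \<le> real (N (k n)) * h (k n)"
            using i h(1)[of "k n"] by (intro mult_right_mono) auto
          then have "real i * h (k n) \<le> T - t0" using h(2)[of "k n"] by linarith
          then have "h (k n) * speed x0 (real i * h (k n)) \<le> h (k n) * K"
            unfolding K_def using h(1)[of "k n"] by (intro mult_left_mono speed_mono) auto
          then show ?thesis using X(2)[of i "k n"] i by auto
        qed
      qed (use t0 t d K h X(2) lim in \<open>auto simp: \<Phi>_def\<close>)
      moreover have "?D = f t (x t) - (f t (x t) - ?D)" by simp
      ultimately show "x differentiable (at t within {t0..T}) \<and>
          ?D \<in> {f t (x t) - \<eta> |\<eta>. \<eta> \<in> A t (x t) (x t)}"
        using d by blast
    qed
  qed
  moreover have "AE t in lebesgue_on {t0..T}. norm (vector_derivative x (at t within {t0..T})) \<le> speed x0 (t - t0)"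
    using ae
  proof (rule lebesgue_on_mono)
    fix t assume d: "x differentiable (at t within {t0..T}) \<and> t < T" and t: "t \<in> {t0..T}"
    have "((\<lambda>r. norm ((1 / r) *\<^sub>R (x (t + r) - x t))) \<longlongrightarrow> norm (vector_derivative x (at t within {t0..T}))) (at_right 0)"
      using right_quotient d t by (intro tendsto_intros) auto
    \<comment> \<open>The increment over \<open>{t..t + r}\<close> is bounded with the speed at its
      right end, so the bound at \<open>t\<close> emerges only by continuity as \<open>r\<close>
      tends to 0.\<close>
    moreover have "((\<lambda>r. speed x0 (t + r - t0)) \<longlongrightarrow> speed x0 (t + 0 - t0)) (at_right 0)"
      unfolding speed_def by (intro tendsto_intros)
    moreover have "\<forall>\<^sub>F r in at_right 0. norm ((1 / r) *\<^sub>R (x (t + r) - x t)) \<le> speed x0 (t + r - t0)"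
      unfolding eventually_at_right_field
    proof (intro exI conjI allI impI)
      show "0 < T - t" using d by simp
      fix r :: real assume r: "0 < r" "r < T - t"
      have "norm (x (t + r) - x t) \<le> speed x0 (t + r - t0) * r"
        using x_speed[of t "t + r"] t r by simp
      then show "norm ((1 / r) *\<^sub>R (x (t + r) - x t)) \<le> speed x0 (t + r - t0)"
        using r by (simp add: divide_le_eq)
    qed
    ultimately show "norm (vector_derivative x (at t within {t0..T})) \<le> speed x0 (t - t0)"
      using tendsto_le[OF trivial_limit_at_right_real] by fastforce
  qed
  moreover have "\<forall>t\<in>{t0..T}. norm (x t - x0) \<le> speed x0 (t - t0) * (t - t0)"
    using x_speed[of t0] x_t0 by auto
  ultimately show ?thesis by blast
qed

lemma solution_exists:
  assumes t0: "t0 \<in> {0..T}" and x0: "x0 \<in> op_dom (A t0 x0)"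
  shows "\<exists>x. is_solution A f t0 T x0 x \<and>
      (AE t in lebesgue_on {t0..T}. norm (vector_derivative x (at t within {t0..T})) \<le> speed x0 (t - t0)) \<and>
      (\<forall>t\<in>{t0..T}. norm (x t - x0) \<le> speed x0 (t - t0) * (t - t0))"
proof (cases "t0 < T")
  case True
  then show ?thesis using t0 x0 by (intro solution_exists_nondegenerate) auto
next
  case False
  then have t0T: "t0 = T" using t0 by simp
  \<comment> \<open>A one-point interval is null, so the inclusion and the speed bound hold
    vacuously almost everywhere and the constant curve is a solution.\<close>
  have AE: "AE t in lebesgue_on {T..T}. P t" for P
    by (rule AE_I'[of "{T}"]) (auto simp: null_sets_restrict_space)
  have "0-lipschitz_on {T..T} (\<lambda>_. x0)" by (rule lipschitz_onI) auto
  from absolutely_continuous_on_interval_Lipschitz[OF this]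
  have "is_solution A f t0 T x0 (\<lambda>_. x0)"
    unfolding is_solution_def t0T using AE by blast
  moreover have "\<forall>t\<in>{t0..T}. norm (x0 - x0) \<le> speed x0 (t - t0) * (t - t0)"
    by (simp add: t0T)
  ultimately show ?thesis unfolding t0T using AE by (intro exI[of _ "\<lambda>_. x0"]) blast
qed

end

theorem theorem3p1:
  fixes T L\<^sub>1 L\<^sub>2 c\<^sub>A c\<^sub>f \<delta> :: real
    and A :: "real \<Rightarrow> real ^ 'n \<Rightarrow> ('n::finite) operator"
    and f :: "real \<Rightarrow> real ^ 'n \<Rightarrow> real ^ 'n"
  assumes "T > 0"
    and "\<And>t x. t \<in> {0..T} \<Longrightarrow> maximal_monotone_op (A t x)"
    and "L\<^sub>1 \<ge> 0" and "0 \<le> L\<^sub>2" and "L\<^sub>2 < 1"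
    and "\<And>t s x y. t \<in> {0..T} \<Longrightarrow> s \<in> {0..T} \<Longrightarrow>
           vladimirov_dis (A t x) (A s y) \<le> ereal (L\<^sub>1 * \<bar>t - s\<bar> + L\<^sub>2 * norm (x - y))"
    and "c\<^sub>A > 0"
    and "\<And>t x y. t \<in> {0..T} \<Longrightarrow> y \<in> op_dom (A t x) \<Longrightarrow>
           norm (min_section (A t x) y) \<le> c\<^sub>A * (1 + norm x + norm y)"
    and "continuous_on ({0..T} \<times> UNIV) (\<lambda>(t, x). f t x)"
    and "c\<^sub>f > 0"
    and "\<And>t x. t \<in> {0..T} \<Longrightarrow> norm (f t x) \<le> c\<^sub>f * (1 + norm x)"
    and "\<delta> > 0" and "(1 + \<delta>) * L\<^sub>2 < 1"
  shows "(\<forall>x0 :: real ^ 'n. m_bound \<delta> L\<^sub>1 L\<^sub>2 c\<^sub>A c\<^sub>f x0 > 0) \<and>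
     continuous_on UNIV (m_bound \<delta> L\<^sub>1 L\<^sub>2 c\<^sub>A c\<^sub>f :: real ^ 'n \<Rightarrow> real) \<and>
     (\<forall>t0\<in>{0..T}. \<forall>x0. x0 \<in> op_dom (A t0 x0) \<longrightarrow>
       (\<exists>x. is_solution A f t0 T x0 x \<and>
          (AE t in lebesgue_on ({t0..t0 + 1} \<inter> {t0..T}).
             norm (vector_derivative x (at t within {t0..T})) \<le> m_bound \<delta> L\<^sub>1 L\<^sub>2 c\<^sub>A c\<^sub>f x0) \<and>
          (\<forall>t\<in>{t0..t0 + 1} \<inter> {t0..T}. norm (x t) \<le> norm x0 + m_bound \<delta> L\<^sub>1 L\<^sub>2 c\<^sub>A c\<^sub>f x0)))"
proof -
  interpret state_dependent_inclusion T L\<^sub>1 L\<^sub>2 c\<^sub>A c\<^sub>f \<delta> A f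
    by unfold_locales (use assms in auto)
  let ?m = "m_bound \<delta> L\<^sub>1 L\<^sub>2 c\<^sub>A c\<^sub>f :: real ^ 'n \<Rightarrow> real"
  have m: "?m = (\<lambda>x0. (2 * norm x0 + 2 * C) * exp (6 * C))"
    by (simp add: m_bound_def C_def fun_eq_iff)
  have "\<forall>x0. ?m x0 > 0"
    unfolding m using C_pos by (intro allI mult_pos_pos add_nonneg_pos) auto
  moreover have "continuous_on UNIV ?m"
    unfolding m by (intro continuous_intros)
  moreover have "\<exists>x. is_solution A f t0 T x0 x \<and>
      (AE t in lebesgue_on ({t0..t0 + 1} \<inter> {t0..T}).
        norm (vector_derivative x (at t within {t0..T})) \<le> ?m x0) \<and>
      (\<forall>t\<in>{t0..t0 + 1} \<inter> {t0..T}. norm (x t) \<le> norm x0 + ?m x0)"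
    if t0: "t0 \<in> {0..T}" and x0: "x0 \<in> op_dom (A t0 x0)" for t0 x0
  proof -
    obtain x where x: "is_solution A f t0 T x0 x"
      "AE t in lebesgue_on {t0..T}. norm (vector_derivative x (at t within {t0..T})) \<le> speed x0 (t - t0)"
      "\<forall>t\<in>{t0..T}. norm (x t - x0) \<le> speed x0 (t - t0) * (t - t0)"
      using solution_exists[OF t0 x0] by blast
    \<comment> \<open>The restriction to one unit of time enters here: it reduces
      \<open>speed\<close> to its value at 1, the value that \<open>m_bound\<close>
      dominates.\<close>
    have speed_le: "speed x0 (t - t0) \<le> ?m x0" if "t \<in> {t0..t0 + 1}" for t
      using speed_mono[of "t - t0" 1 x0] speed_1_le_m_bound[of x0] that by auto
    have "AE t in lebesgue. t \<in> {t0..T} \<longrightarrow>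
        norm (vector_derivative x (at t within {t0..T})) \<le> speed x0 (t - t0)"
      using x(2) by (subst (asm) AE_restrict_space_iff) auto
    then have "AE t in lebesgue. t \<in> {t0..t0 + 1} \<inter> {t0..T} \<longrightarrow>
        norm (vector_derivative x (at t within {t0..T})) \<le> ?m x0"
      by (rule eventually_mono) (use speed_le in force)
    then have "AE t in lebesgue_on ({t0..t0 + 1} \<inter> {t0..T}).
        norm (vector_derivative x (at t within {t0..T})) \<le> ?m x0"
      by (subst AE_restrict_space_iff) auto
    moreover have "norm (x t) \<le> norm x0 + ?m x0" if t: "t \<in> {t0..t0 + 1} \<inter> {t0..T}" for t
    proof -
      have "norm (x t - x0) \<le> speed x0 (t - t0) * (t - t0)" using x(3) t by blast
      also have "\<dots> \<le> speed x0 (t - t0) * 1"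
        using t speed_nonneg by (intro mult_left_mono) auto
      also have "\<dots> \<le> ?m x0" using speed_le t by simp
      finally show ?thesis using norm_triangle_sub[of "x t" x0] by linarith
    qed
    ultimately show ?thesis using x(1) by blast
  qed
  ultimately show ?thesis by blast
qed

end
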